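(* Let $G$ be a countable residually finite group and let $\overleftarrow{G}$ be a totally disconnected metric compactification of $G$, equipped with the action of $G$ by left multiplication. Then there exist a uniquely ergodic Toeplitz $G$-subshift $(X,\sigma,G)$ and an almost one-to-one factor map $\pi:X\to\overleftarrow{G}$ such that, if $\nu$ denotes the unique invariant (ergodic) probability measure of $(X,\sigma,G)$, then $\pi$ is a measure conjugacy between $(X,\sigma,G,\nu)$ and $\overleftarrow{G}$ endowed with its Haar probability measure.
   Context: A totally disconnected metric compactification of $G$ is a compact, metrizable, totally disconnected topological group $\overleftarrow{G}$ with an injective homomorphism $i:G\to\overleftarrow{G}$ with dense image; $G$ acts by $g\cdot y=i(g)y$. For a finite alphabet $\Sigma$ ($|\Sigma|\ge2$), $\Sigma^G$ has the product topology and shift $\sigma^g x(h)=x(g^{-1}h)$. For $x\in\Sigma^G$, finite index $\Gamma\le G$, $\alpha\in\Sigma$: $\mathrm{Per}(x,\Gamma,\alpha)=\{g: x(\gamma g)=\alpha\ \forall\gamma\in\Gamma\}$, $\mathrm{Per}(x,\Gamma)=\bigcup_\alpha\mathrm{Per}(x,\Gamma,\alpha)$. $\eta$ is a Toeplitz array if every $g\in G$ lies in $\mathrm{Per}(\eta,\Gamma)$ for some finite index $\Gamma$; a Toeplitz $G$-subshift is the orbit closure of a Toeplitz array. A factor map $\pi$ onto a minimal system is almost one-to-one if some point has exactly one preimage. A measure conjugacy between p.m.p. systems $(X,\mu)$ and $(Y,\nu)$ is a bimeasurable bijection between invariant conull subsets, intertwining the actions and pushing $\mu$ to $\nu$. 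*)

theory Defs
  imports "HOL-Algebra.Coset" "HOL-Analysis.Analysis"
begin

definition finite_index :: "'g set \<Rightarrow> 'g monoid \<Rightarrow> bool" where
  "finite_index H G \<longleftrightarrow> subgroup H G \<and> finite (rcosets\<^bsub>G\<^esub> H)"

definition residually_finite :: "'g monoid \<Rightarrow> bool" where
  "residually_finite G \<longleftrightarrow> group G \<and>
     (\<forall>g\<in>carrier G. g \<noteq> \<one>\<^bsub>G\<^esub> \<longrightarrow>
        (\<exists>H. H \<lhd> G \<and> finite (rcosets\<^bsub>G\<^esub> H) \<and> g \<notin> H))"

definition topological_group :: "'k monoid \<Rightarrow> 'k topology \<Rightarrow> bool" where
  "topological_group K T \<longleftrightarrow> group K \<and> topspace T = carrier K \<and>
     continuous_map (prod_topology T T) T (\<lambda>(x, y). x \<otimes>\<^bsub>K\<^esub> y) \<and>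
     continuous_map T T (\<lambda>x. inv\<^bsub>K\<^esub> x)"

definition totally_disconnected_space :: "'a topology \<Rightarrow> bool" where
  "totally_disconnected_space T \<longleftrightarrow>
     (\<forall>x\<in>topspace T. connected_component_of_set T x = {x})"

definition td_metric_compactification ::
    "'g monoid \<Rightarrow> 'k monoid \<Rightarrow> 'k topology \<Rightarrow> ('g \<Rightarrow> 'k) \<Rightarrow> bool" where
  "td_metric_compactification G K T i \<longleftrightarrow>
     topological_group K T \<and> compact_space T \<and> metrizable_space T \<and>
     totally_disconnected_space T \<and>
     i \<in> hom G K \<and> inj_on i (carrier G) \<and>
     T closure_of (i ` carrier G) = topspace T"

definition borel_of :: "'a topology \<Rightarrow> 'a measure" where
  "borel_of T = sigma (topspace T) {U. openin T U}"

definition full_shift_top :: "'g monoid \<Rightarrow> 's set \<Rightarrow> ('g \<Rightarrow> 's) topology" where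
  "full_shift_top G S = product_topology (\<lambda>_. discrete_topology S) (carrier G)"

definition shift :: "'g monoid \<Rightarrow> 'g \<Rightarrow> ('g \<Rightarrow> 's) \<Rightarrow> ('g \<Rightarrow> 's)" where
  "shift G g x = (\<lambda>h\<in>carrier G. x (inv\<^bsub>G\<^esub> g \<otimes>\<^bsub>G\<^esub> h))"

definition Per :: "'g monoid \<Rightarrow> ('g \<Rightarrow> 's) \<Rightarrow> 'g set \<Rightarrow> 's \<Rightarrow> 'g set" where
  "Per G x \<Gamma> \<alpha> = {g \<in> carrier G. \<forall>\<gamma>\<in>\<Gamma>. x (\<gamma> \<otimes>\<^bsub>G\<^esub> g) = \<alpha>}"

definition toeplitz_array :: "'g monoid \<Rightarrow> 's set \<Rightarrow> ('g \<Rightarrow> 's) \<Rightarrow> bool" where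
  "toeplitz_array G S \<eta> \<longleftrightarrow> \<eta> \<in> carrier G \<rightarrow>\<^sub>E S \<and>
     (\<forall>g\<in>carrier G. \<exists>\<Gamma> \<alpha>. finite_index \<Gamma> G \<and> \<alpha> \<in> S \<and> g \<in> Per G \<eta> \<Gamma> \<alpha>)"

definition orbit_closure :: "'g monoid \<Rightarrow> 's set \<Rightarrow> ('g \<Rightarrow> 's) \<Rightarrow> ('g \<Rightarrow> 's) set" where
  "orbit_closure G S \<eta> = full_shift_top G S closure_of {shift G g \<eta> | g. g \<in> carrier G}"

definition toeplitz_subshift :: "'g monoid \<Rightarrow> 's set \<Rightarrow> ('g \<Rightarrow> 's) set \<Rightarrow> bool" where
  "toeplitz_subshift G S X \<longleftrightarrow> (\<exists>\<eta>. toeplitz_array G S \<eta> \<and> X = orbit_closure G S \<eta>)"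

definition invariant_prob :: "'g monoid \<Rightarrow> 's set \<Rightarrow> ('g \<Rightarrow> 's) set \<Rightarrow> ('g \<Rightarrow> 's) measure \<Rightarrow> bool" where
  "invariant_prob G S X \<nu> \<longleftrightarrow>
     sets \<nu> = sets (borel_of (subtopology (full_shift_top G S) X)) \<and>
     emeasure \<nu> X = 1 \<and>
     (\<forall>g\<in>carrier G. \<forall>A\<in>sets \<nu>. emeasure \<nu> (shift G g -` A \<inter> X) = emeasure \<nu> A)"

definition uniquely_ergodic :: "'g monoid \<Rightarrow> 's set \<Rightarrow> ('g \<Rightarrow> 's) set \<Rightarrow> bool" where
  "uniquely_ergodic G S X \<longleftrightarrow> (\<exists>!\<nu>. invariant_prob G S X \<nu>)"

definition almost_one_one_factor ::
    "'g monoid \<Rightarrow> 's set \<Rightarrow> ('g \<Rightarrow> 's) set \<Rightarrow> 'k monoid \<Rightarrow> 'k topology \<Rightarrow> ('g \<Rightarrow> 'k)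
     \<Rightarrow> (('g \<Rightarrow> 's) \<Rightarrow> 'k) \<Rightarrow> bool" where
  "almost_one_one_factor G S X K T i \<pi> \<longleftrightarrow>
     continuous_map (subtopology (full_shift_top G S) X) T \<pi> \<and>
     \<pi> ` X = topspace T \<and>
     (\<forall>g\<in>carrier G. \<forall>x\<in>X. \<pi> (shift G g x) = i g \<otimes>\<^bsub>K\<^esub> \<pi> x) \<and>
     (\<exists>y\<in>topspace T. \<exists>!x. x \<in> X \<and> \<pi> x = y)"

definition haar_prob :: "'k monoid \<Rightarrow> 'k topology \<Rightarrow> 'k measure \<Rightarrow> bool" where
  "haar_prob K T \<mu> \<longleftrightarrow>
     sets \<mu> = sets (borel_of T) \<and> emeasure \<mu> (topspace T) = 1 \<and>
     (\<forall>k\<in>carrier K. \<forall>A\<in>sets \<mu>.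
        emeasure \<mu> ((\<lambda>y. k \<otimes>\<^bsub>K\<^esub> y) -` A \<inter> topspace T) = emeasure \<mu> A)"

definition measure_conjugacy ::
    "'x measure \<Rightarrow> 'y measure \<Rightarrow> ('g \<Rightarrow> 'x \<Rightarrow> 'x) \<Rightarrow> ('g \<Rightarrow> 'y \<Rightarrow> 'y) \<Rightarrow> 'g set
     \<Rightarrow> ('x \<Rightarrow> 'y) \<Rightarrow> bool" where
  "measure_conjugacy M N a b I f \<longleftrightarrow>
     (\<exists>X0 Y0. X0 \<in> sets M \<and> Y0 \<in> sets N \<and>
        emeasure M (space M - X0) = 0 \<and> emeasure N (space N - Y0) = 0 \<and>
        (\<forall>g\<in>I. a g ` X0 = X0) \<and> (\<forall>g\<in>I. b g ` Y0 = Y0) \<and>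
        bij_betw f X0 Y0 \<and>
        f \<in> measurable (restrict_space M X0) (restrict_space N Y0) \<and>
        the_inv_into X0 f \<in> measurable (restrict_space N Y0) (restrict_space M X0) \<and>
        (\<forall>g\<in>I. \<forall>x\<in>X0. f (a g x) = b g (f x)) \<and>
        (\<forall>A\<in>sets N. A \<subseteq> Y0 \<longrightarrow> emeasure M (f -` A \<inter> X0) = emeasure N A))"

end

theory Submission
  imports Defs
begin

text \<open>
  Write \<open>K\<close> for the compactification and \<open>i\<close> for the embedding. The Toeplitz array is
  \<open>\<eta> h = f (i h)\<close> for a two-valued \<open>f\<close> on \<open>K\<close> that is locally constant off a single
  point \<open>z\<close> outside the countable set \<open>i(G)\<close> and takes both values in every punctured
  neighbourhood of \<open>z\<close>: the parity of the depth of \<open>y\<close> in a strictly decreasing chain of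
  clopen cosets shrinking to \<open>z\<close>. (If \<open>K\<close> is finite, \<open>f\<close> is the indicator of the identity.)
  If \<open>f (c \<otimes> y) = f y\<close> wherever both sides make sense and \<open>c \<noteq> \<one>\<close>, then \<open>f\<close> would be constant
  near \<open>z\<close>, since it is constant near \<open>c \<otimes> z\<close>; hence \<open>f\<close> has no periods. Therefore a point \<open>x\<close>
  of the orbit closure determines the unique \<open>k\<close> with \<open>x h = f (k\<^sup>-\<^sup>1 \<otimes> i h)\<close> whenever
  \<open>k\<^sup>-\<^sup>1 \<otimes> i h \<noteq> z\<close>, which defines the factor map. Its fibre over \<open>k\<close> is a single point unless
  \<open>k\<close> lies in the countable, hence Haar-null, set \<open>i(G) \<otimes> z\<^sup>-\<^sup>1\<close>. Every invariant probability
  measure projects to Haar measure because \<open>i(G)\<close> is dense, so it is the unique lift of Haar measure.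
\<close>

section \<open>Profinite groups\<close>

locale profinite_group = group K for K :: "'k monoid" (structure) +
  fixes T :: "'k topology"
  assumes topspace: "topspace T = carrier K"
    and continuous_mult: "continuous_map (prod_topology T T) T (\<lambda>(x, y). x \<otimes> y)"
    and continuous_inv: "continuous_map T T (\<lambda>x. inv x)"
    and compact: "compact_space T"
    and metrizable: "metrizable_space T"
    and totally_disconnected: "totally_disconnected_space T"
begin

lemma cancel_left [simp]:
  assumes "x \<in> carrier K" "y \<in> carrier K"
  shows "x \<otimes> (inv x \<otimes> y) = y" "inv x \<otimes> (x \<otimes> y) = y"
  using assms by (simp_all add: m_assoc[symmetric])

lemma Hausdorff: "Hausdorff_space T"
  using metrizable by (rule metrizable_imp_Hausdorff_space)

lemma continuous_mult_comp:
  assumes "continuous_map X T f" "continuous_map X T g"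
  shows "continuous_map X T (\<lambda>x. f x \<otimes> g x)"
proof -
  have "continuous_map X (prod_topology T T) (\<lambda>x. (f x, g x))"
    using assms by (simp add: continuous_map_pairedI)
  from continuous_map_compose[OF this continuous_mult] show ?thesis
    by (simp add: o_def)
qed

lemma continuous_inv_comp: "continuous_map X T f \<Longrightarrow> continuous_map X T (\<lambda>x. inv (f x))"
  using continuous_map_compose[of X T f T "\<lambda>x. inv x"] continuous_inv by (simp add: o_def)

lemma continuous_const: "k \<in> carrier K \<Longrightarrow> continuous_map X T (\<lambda>x. k)"
  by (simp add: topspace)

lemmas continuous_group_ops = continuous_mult_comp continuous_inv_comp continuous_const

text \<open>In a compact Hausdorff space a component contained in an open set can be separated from
  the complement of that set by a clopen set. Total disconnectedness makes the component of the
  identity a singleton.\<close>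

lemma clopen_basis_one:
  assumes "openin T W" "\<one> \<in> W"
  obtains U where "openin T U" "closedin T U" "\<one> \<in> U" "U \<subseteq> W"
proof -
  have "{\<one>} \<in> connected_components_of T"
    using totally_disconnected topspace
    unfolding totally_disconnected_space_def connected_components_of_def by force
  moreover have "compactin T {\<one>}" by (simp add: topspace)
  ultimately obtain U V where UV: "openin T U" "openin T V" "disjnt U V"
      "U \<union> V = topspace T" "{\<one>} \<subseteq> U" "U \<subseteq> W"
    using wilder_locally_compact_component_thm[of T "{\<one>}" W] assms compact Hausdorff
      compact_imp_locally_compact_space by auto
  then have "U = topspace T - V" "\<one> \<in> U" using UV openin_subset[of T] by (auto simp: disjnt_iff)
  then show thesis using that[of U] UV by (metis closedin_def openin_closedin_eq openin_subset double_diff order_refl Diff_subset)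
qed

text \<open>The subgroup is the right stabilizer of a clopen neighbourhood of the identity.\<close>

lemma open_subgroup_basis:
  assumes "openin T W" "\<one> \<in> W"
  obtains V where "subgroup V K" "openin T V" "V \<subseteq> W"
proof -
  obtain U where U: "openin T U" "closedin T U" "\<one> \<in> U" "U \<subseteq> W"
    using clopen_basis_one assms by blast
  have Uc: "U \<subseteq> carrier K" using U(1) openin_subset topspace by blast
  \<comment> \<open>The complement is the projection of a closed subset of the product along the
    compact first factor, hence closed. Taking \<open>\<phi>\<close> to be the identity and then
    inversion gives the two halves of \<open>V\<close>, so \<open>V\<close> is closed under
    inverses.\<close>
  have stab_open: "openin T {v \<in> carrier K. \<forall>w\<in>U. w \<otimes> \<phi> v \<in> U}" if \<phi>: "continuous_map T T \<phi>" for \<phi>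
  proof -
    let ?P = "prod_topology T T"
    have "continuous_map ?P T (\<lambda>p. fst p \<otimes> \<phi> (snd p))"
      by (intro continuous_mult_comp continuous_map_fst continuous_map_compose[OF continuous_map_snd \<phi>, unfolded o_def])
    then have "closedin ?P {p \<in> topspace ?P. fst p \<otimes> \<phi> (snd p) \<in> topspace T - U}"
      by (rule closedin_continuous_map_preimage) (use U in auto)
    moreover have "closedin ?P {p \<in> topspace ?P. fst p \<in> U}"
      by (rule closedin_continuous_map_preimage[OF continuous_map_fst U(2)])
    moreover define Z where "Z = {p \<in> topspace ?P. fst p \<otimes> \<phi> (snd p) \<in> topspace T - U}
      \<inter> {p \<in> topspace ?P. fst p \<in> U}"
    ultimately have "closedin ?P Z" by (simp only: closedin_Int)
    then have "closedin T (snd ` Z)"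
      using closed_map_snd[OF compact, of T] by (simp add: closed_map_def)
    then have "openin T (topspace T - snd ` Z)" by blast
    have \<phi>_carrier: "\<phi> v \<in> carrier K" if "v \<in> carrier K" for v
      using continuous_map_funspace[OF \<phi>] that by (auto simp: topspace)
    have "snd ` Z = {v \<in> carrier K. \<exists>w\<in>U. w \<otimes> \<phi> v \<notin> U}"
    proof (intro equalityI subsetI)
      fix v assume "v \<in> {v \<in> carrier K. \<exists>w\<in>U. w \<otimes> \<phi> v \<notin> U}"
      then obtain w where "v \<in> carrier K" "w \<in> U" "w \<otimes> \<phi> v \<notin> U" by blast
      then have "(w, v) \<in> Z" using Uc \<phi>_carrier by (auto simp: Z_def topspace)
      then show "v \<in> snd ` Z" by force
    qed (auto simp: Z_def topspace)
    then have "topspace T - snd ` Z = {v \<in> carrier K. \<forall>w\<in>U. w \<otimes> \<phi> v \<in> U}"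
      by (auto simp: topspace)
    with \<open>openin T (topspace T - snd ` Z)\<close> show ?thesis by simp
  qed
  define V where "V = {v \<in> carrier K. \<forall>w\<in>U. w \<otimes> v \<in> U} \<inter> {v \<in> carrier K. \<forall>w\<in>U. w \<otimes> inv v \<in> U}"
  have "openin T V" unfolding V_def
    using stab_open[of "\<lambda>v. v"] stab_open[OF continuous_inv] by auto
  \<comment> \<open>Apply the stabilizer condition to the identity, which lies in
    \<open>U\<close>.\<close>
  moreover have "V \<subseteq> W" using U by (force simp: V_def)
  moreover have "subgroup V K"
  proof (rule subgroupI)
    have "\<one> \<in> V" using Uc by (auto simp: V_def)
    then show "V \<noteq> {}" by blast
  next
    fix a b assume "a \<in> V" "b \<in> V"
    moreover from this have "w \<otimes> (a \<otimes> b) = (w \<otimes> a) \<otimes> b" "w \<otimes> inv (a \<otimes> b) = (w \<otimes> inv b) \<otimes> inv a"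
      if "w \<in> U" for w
      using that Uc by (auto simp: V_def m_assoc inv_mult_group subset_iff)
    ultimately show "a \<otimes> b \<in> V" by (auto simp: V_def)
  qed (auto simp: V_def)
  ultimately show thesis using that by blast
qed

text \<open>Metrizability gives a countable neighbourhood basis at the identity. Choosing each
  subgroup inside the previous one and inside the next basis set makes the chain both decreasing and
  cofinal.\<close>

lemma open_subgroup_chain:
  obtains V :: "nat \<Rightarrow> 'k set" where "\<And>n. subgroup (V n) K" "\<And>n. openin T (V n)" "decseq V"
    "\<And>U. openin T U \<Longrightarrow> \<one> \<in> U \<Longrightarrow> \<exists>n. V n \<subseteq> U"
proof -
  obtain \<B> where \<B>: "countable \<B>" "\<And>B. B \<in> \<B> \<Longrightarrow> openin T B"
    "\<And>U. openin T U \<Longrightarrow> \<one> \<in> U \<Longrightarrow> \<exists>B\<in>\<B>. \<one> \<in> B \<and> B \<subseteq> U"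
    using metrizable_imp_first_countable[OF metrizable] unfolding first_countable_def topspace
    by (meson one_closed)
  define \<C> where "\<C> = {B \<in> \<B>. \<one> \<in> B}"
  have \<C>: "countable \<C>" "\<C> \<noteq> {}"
    using \<B>(1) \<B>(3)[OF openin_topspace] by (auto simp: \<C>_def topspace)
  define B where "B = from_nat_into \<C>"
  have B: "openin T (B n)" "\<one> \<in> B n" for n
    using from_nat_into[OF \<C>(2), of n] \<B>(2) by (auto simp: B_def \<C>_def)
  let ?P = "\<lambda>n V. subgroup V K \<and> openin T V \<and> V \<subseteq> B n"
  have "\<exists>V. \<forall>n. ?P n (V n) \<and> V (Suc n) \<subseteq> V n"
  proof (rule dependent_nat_choice[where P = ?P and Q = "\<lambda>n V W. W \<subseteq> V"])
    show "\<exists>V. ?P 0 V" using open_subgroup_basis[OF B] by metis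
    fix V n assume "?P n V"
    then have "openin T (V \<inter> B (Suc n))" "\<one> \<in> V \<inter> B (Suc n)"
      using B by (auto simp: subgroup.one_closed)
    then show "\<exists>W. ?P (Suc n) W \<and> W \<subseteq> V" by (metis open_subgroup_basis Int_subset_iff)
  qed
  then obtain V where V: "\<And>n. ?P n (V n)" "\<And>n. V (Suc n) \<subseteq> V n" by blast
  show thesis
  proof (rule that[of V])
    show "decseq V" using V(2) by (simp add: decseq_SucI)
    fix U assume "openin T U" "\<one> \<in> U"
    then obtain C where "C \<in> \<C>" "C \<subseteq> U" using \<B>(3)[of U] by (auto simp: \<C>_def)
    then obtain n where "B n = C" unfolding B_def using \<C> by (meson from_nat_into_surj)
    with V(1)[of n] \<open>C \<subseteq> U\<close> show "\<exists>n. V n \<subseteq> U" by blast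
  qed (use V in auto)
qed

end

section \<open>Left cosets of a decreasing chain of open subgroups\<close>

locale profinite_chain = profinite_group +
  fixes V :: "nat \<Rightarrow> 'a set"
  assumes V_subgroup: "subgroup (V n) K"
    and V_open: "openin T (V n)"
    and V_dec: "decseq V"
    and V_basis: "openin T U \<Longrightarrow> \<one> \<in> U \<Longrightarrow> \<exists>n. V n \<subseteq> U"
begin

lemma lcoset_iff: "k \<in> carrier K \<Longrightarrow> x \<in> k <# V n \<longleftrightarrow> x \<in> carrier K \<and> inv k \<otimes> x \<in> V n"
  using subgroup.subset[OF V_subgroup[of n]]
  by (auto simp: l_coset_def m_assoc[symmetric] subset_iff intro!: bexI[of _ "inv k \<otimes> x"])

lemma lcoset_self: "k \<in> carrier K \<Longrightarrow> k \<in> k <# V n"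
  by (simp add: lcoset_iff subgroup.one_closed[OF V_subgroup])

lemma lcoset_subset: "k \<in> carrier K \<Longrightarrow> k <# V n \<subseteq> carrier K"
  by (auto simp: lcoset_iff)

lemma lcoset_eq:
  assumes "k \<in> carrier K" "x \<in> k <# V n"
  shows "x <# V n = k <# V n"
proof -
  have x: "x \<in> carrier K" "inv k \<otimes> x \<in> V n" using assms by (auto simp: lcoset_iff)
  have "inv x \<otimes> y \<in> V n \<longleftrightarrow> inv k \<otimes> y \<in> V n" if y: "y \<in> carrier K" for y
  proof -
    have "inv k \<otimes> y = (inv k \<otimes> x) \<otimes> (inv x \<otimes> y)" "inv x \<otimes> y = inv (inv k \<otimes> x) \<otimes> (inv k \<otimes> y)"
      using assms x y by (simp_all add: m_assoc inv_mult_group)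
    then show ?thesis using x V_subgroup[of n] by (metis subgroup.m_closed subgroup.m_inv_closed)
  qed
  then show ?thesis using assms x by (auto simp: lcoset_iff)
qed

lemma lcoset_open: "k \<in> carrier K \<Longrightarrow> openin T (k <# V n)"
proof -
  assume k: "k \<in> carrier K"
  have "continuous_map T T (\<lambda>x. inv k \<otimes> x)"
    using k by (intro continuous_group_ops) (auto simp: continuous_map_id[unfolded id_def])
  then have "openin T {x \<in> topspace T. inv k \<otimes> x \<in> V n}"
    using V_open by (rule openin_continuous_map_preimage)
  moreover have "{x \<in> topspace T. inv k \<otimes> x \<in> V n} = k <# V n"
    using k by (auto simp: lcoset_iff topspace)
  ultimately show ?thesis by simp
qed

lemma lcoset_mono: "m \<le> n \<Longrightarrow> k <# V n \<subseteq> k <# V m"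
  using decseqD[OF V_dec] by (force simp: l_coset_def)

lemma lcoset_basis:
  assumes "openin T U" "k \<in> U"
  shows "\<exists>n. k <# V n \<subseteq> U"
proof -
  have k: "k \<in> carrier K" using assms openin_subset topspace by blast
  have "continuous_map T T (\<lambda>x. k \<otimes> x)"
    using k by (intro continuous_group_ops) (auto simp: continuous_map_id[unfolded id_def])
  from openin_continuous_map_preimage[OF this assms(1)]
  obtain n where "V n \<subseteq> {x \<in> topspace T. k \<otimes> x \<in> U}"
    using V_basis[of "{x \<in> topspace T. k \<otimes> x \<in> U}"] assms k by (auto simp: topspace)
  then show ?thesis by (auto simp: l_coset_def)
qed

text \<open>The groups \<open>V n\<close> need not be normal, so left cosets are used throughout:
  left translations permute them.\<close>

definition lcosets :: "nat \<Rightarrow> 'a set set" where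
  "lcosets n = (\<lambda>k. k <# V n) ` carrier K"

lemma lcosets_disjoint: "P \<in> lcosets n \<Longrightarrow> Q \<in> lcosets n \<Longrightarrow> P \<noteq> Q \<Longrightarrow> P \<inter> Q = {}"
  unfolding lcosets_def using lcoset_eq by blast

lemma Union_lcosets: "\<Union>(lcosets n) = carrier K"
  unfolding lcosets_def using lcoset_self lcoset_subset by blast

lemma lcosets_nonempty: "P \<in> lcosets n \<Longrightarrow> P \<noteq> {}"
  unfolding lcosets_def using lcoset_self by blast

lemma lcosets_open: "P \<in> lcosets n \<Longrightarrow> openin T P"
  unfolding lcosets_def using lcoset_open by blast

text \<open>The cosets partition \<open>K\<close> into nonempty open sets, so a finite subcover must
  already contain every one of them.\<close>

lemma finite_lcosets: "finite (lcosets n)"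
proof -
  obtain \<F> where \<F>: "finite \<F>" "\<F> \<subseteq> lcosets n" "carrier K \<subseteq> \<Union>\<F>"
    using compactinD[OF compact[unfolded compact_space_def], of "lcosets n"]
      lcosets_open Union_lcosets[of n] topspace by auto
  have "P \<in> \<F>" if P: "P \<in> lcosets n" for P
  proof -
    obtain x where x: "x \<in> P" using lcosets_nonempty[OF P] by blast
    have "x \<in> carrier K" using x P Union_lcosets[of n] by blast
    then obtain Q where Q: "Q \<in> \<F>" "x \<in> Q" using \<F>(3) by blast
    then have "P \<inter> Q \<noteq> {}" using x by blast
    then have "P = Q" using lcosets_disjoint[OF P, of Q] \<F>(2) Q by blast
    then show ?thesis using Q by simp
  qed
  then have "lcosets n \<subseteq> \<F>" by blast
  then show ?thesis using \<F>(1) by (rule finite_subset)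
qed

lemma lcosets_closed: 
  assumes P: "P \<in> lcosets n" shows "closedin T P"
proof -
  have "openin T (\<Union>(lcosets n - {P}))" using lcosets_open by blast
  moreover have "\<Union>(lcosets n - {P}) = topspace T - P"
    using lcosets_disjoint[OF P] P Union_lcosets[of n] unfolding topspace by fast
  moreover have "P \<subseteq> topspace T" using P Union_lcosets[of n] topspace by blast
  ultimately show ?thesis by (simp add: closedin_def)
qed

section \<open>Counting cosets: an invariant content on clopen sets\<close>

definition saturated :: "nat \<Rightarrow> 'a set \<Rightarrow> bool" where
  "saturated n A \<longleftrightarrow> A \<subseteq> carrier K \<and> (\<forall>k\<in>A. k <# V n \<subseteq> A)"

lemma saturated_mono: "saturated m A \<Longrightarrow> m \<le> n \<Longrightarrow> saturated n A"
  unfolding saturated_def using lcoset_mono[of m n] by (meson subset_trans)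

lemma saturated_lcoset: "k \<in> carrier K \<Longrightarrow> saturated n (k <# V n)"
  unfolding saturated_def by (simp add: lcoset_eq lcoset_subset)

lemma saturated_carrier: "saturated n (carrier K)"
  unfolding saturated_def by (simp add: lcoset_subset)

text \<open>Each point of \<open>A\<close> has a coset inside \<open>A\<close>. Compactness of
  \<open>A\<close> leaves finitely many levels to consider, and any level beyond them works for all
  points at once.\<close>

lemma clopen_saturated:
  assumes "openin T A" "closedin T A"
  shows "\<exists>m. saturated m A"
proof -
  have Ac: "A \<subseteq> carrier K" using assms openin_subset topspace by blast
  have "\<forall>k\<in>A. \<exists>n. k <# V n \<subseteq> A" using lcoset_basis[OF assms(1)] by blast
  then obtain N where N: "\<And>k. k \<in> A \<Longrightarrow> k <# V (N k) \<subseteq> A"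
    unfolding bchoice_iff by blast
  have "compactin T A" using closedin_compact_space[OF compact assms(2)] .
  moreover have "\<forall>U \<in> (\<lambda>k. k <# V (N k)) ` A. openin T U"
    using Ac by (auto intro!: lcoset_open)
  moreover have "A \<subseteq> \<Union>((\<lambda>k. k <# V (N k)) ` A)"
    using Ac by (auto intro!: lcoset_self)
  ultimately have "\<exists>\<F>. finite \<F> \<and> \<F> \<subseteq> (\<lambda>k. k <# V (N k)) ` A \<and> A \<subseteq> \<Union>\<F>"
    unfolding compactin_def by simp
  then obtain F where F: "finite F" "F \<subseteq> A" "A \<subseteq> (\<Union>k\<in>F. k <# V (N k))"
    unfolding ex_finite_subset_image by blast
  \<comment> \<open>The sum serves as a common upper bound of the levels; unlike a maximum it needs
    no separate case for empty \<open>F\<close>.\<close>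
  define m where "m = (\<Sum>k\<in>F. N k)"
  have "k <# V m \<subseteq> A" if k: "k \<in> A" for k
  proof -
    obtain j where j: "j \<in> F" "k \<in> j <# V (N j)" using F(3) k by auto
    then have "N j \<le> m" unfolding m_def using F(1) by (simp add: member_le_sum)
    then have "k <# V m \<subseteq> k <# V (N j)" by (rule lcoset_mono)
    also have "\<dots> = j <# V (N j)" using lcoset_eq[of j k "N j"] j F(2) Ac by auto
    also have "\<dots> \<subseteq> A" using N[of j] j F(2) by auto
    finally show ?thesis .
  qed
  then show ?thesis using Ac by (auto simp: saturated_def)
qed

definition count :: "nat \<Rightarrow> 'a set \<Rightarrow> nat" where
  "count n A = card {Q \<in> lcosets n. Q \<subseteq> A}"

lemma count_translate:
  assumes k: "k \<in> carrier K" and A: "A \<subseteq> carrier K"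
  shows "count n ((\<lambda>x. k \<otimes> x) ` A) = count n A"
proof -
  have tr: "(\<lambda>x. j \<otimes> x) ` Q \<in> lcosets n" if Q: "Q \<in> lcosets n" "j \<in> carrier K" for Q j
  proof -
    obtain l where l: "l \<in> carrier K" "Q = l <# V n" using Q by (auto simp: lcosets_def)
    have "(\<lambda>x. j \<otimes> x) ` Q = (j \<otimes> l) <# V n"
      using l Q(2) subgroup.mem_carrier[OF V_subgroup[of n]] by (simp add: l_coset_def image_UN m_assoc)
    then show ?thesis using l Q(2) by (auto simp: lcosets_def)
  qed
  have cancel: "(\<lambda>x. inv j \<otimes> x) ` (\<lambda>x. j \<otimes> x) ` B = B" if "j \<in> carrier K" "B \<subseteq> carrier K" for j B
  proof -
    have "inv j \<otimes> (j \<otimes> x) = x" if "x \<in> B" for x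
      using that \<open>j \<in> carrier K\<close> \<open>B \<subseteq> carrier K\<close> by (simp add: m_assoc[symmetric] subset_iff)
    then show ?thesis by (simp add: image_image)
  qed
  have "bij_betw (\<lambda>Q. (\<lambda>x. k \<otimes> x) ` Q) {Q \<in> lcosets n. Q \<subseteq> A}
      {Q \<in> lcosets n. Q \<subseteq> (\<lambda>x. k \<otimes> x) ` A}"
  proof (rule bij_betw_byWitness[where f' = "\<lambda>Q. (\<lambda>x. inv k \<otimes> x) ` Q"])
    have "Q \<in> lcosets n \<Longrightarrow> Q \<subseteq> carrier K" for Q using Union_lcosets by blast
    then show "\<forall>Q\<in>{Q \<in> lcosets n. Q \<subseteq> A}. (\<lambda>x. inv k \<otimes> x) ` (\<lambda>x. k \<otimes> x) ` Q = Q"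
      "\<forall>Q\<in>{Q \<in> lcosets n. Q \<subseteq> (\<lambda>x. k \<otimes> x) ` A}. (\<lambda>x. k \<otimes> x) ` (\<lambda>x. inv k \<otimes> x) ` Q = Q"
      using cancel[of k] cancel[of "inv k"] k by auto
    show "(\<lambda>Q. (\<lambda>x. k \<otimes> x) ` Q) ` {Q \<in> lcosets n. Q \<subseteq> A} \<subseteq> {Q \<in> lcosets n. Q \<subseteq> (\<lambda>x. k \<otimes> x) ` A}"
      using tr[OF _ k] by (auto simp del: image_subset_iff intro: image_mono)
    show "(\<lambda>Q. (\<lambda>x. inv k \<otimes> x) ` Q) ` {Q \<in> lcosets n. Q \<subseteq> (\<lambda>x. k \<otimes> x) ` A} \<subseteq> {Q \<in> lcosets n. Q \<subseteq> A}"
      using tr[of _ "inv k"] k A by (auto simp: subset_iff)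
  qed
  then show ?thesis unfolding count_def by (simp add: bij_betw_same_card)
qed

text \<open>A saturated set splits into cosets of level \<open>m\<close>, all of them translates of
  \<open>V m\<close>, and by \<open>count_translate\<close> each contains the same number of cosets
  of level \<open>n\<close>.\<close>

lemma count_refine:
  assumes A: "saturated m A" and mn: "m \<le> n"
  shows "count n A = count m A * count n (V m)"
proof -
  let ?S = "\<lambda>B. {Q \<in> lcosets n. Q \<subseteq> B}"
  have "?S A = (\<Union>P\<in>{P \<in> lcosets m. P \<subseteq> A}. ?S P)"
  proof (intro equalityI subsetI)
    fix Q assume Q: "Q \<in> ?S A"
    then obtain k where k: "k \<in> carrier K" "Q = k <# V n" by (auto simp: lcosets_def)
    then have "k \<in> A" using Q lcoset_self[of k n] by auto
    then have "k <# V m \<in> lcosets m" "k <# V m \<subseteq> A" using A k by (auto simp: saturated_def lcosets_def)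
    moreover have "Q \<in> ?S (k <# V m)" using Q k(2) lcoset_mono[OF mn, of k] by simp
    ultimately show "Q \<in> (\<Union>P\<in>{P \<in> lcosets m. P \<subseteq> A}. ?S P)" by blast
  qed auto
  moreover have "count n P = count n (V m)" if P: "P \<in> lcosets m" for P
  proof -
    obtain k where "k \<in> carrier K" "P = (\<lambda>x. k \<otimes> x) ` V m"
      using P by (auto simp: lcosets_def l_coset_def)
    then show ?thesis using count_translate[OF _ subgroup.subset[OF V_subgroup]] by simp
  qed
  moreover have "card (\<Union>P\<in>{P \<in> lcosets m. P \<subseteq> A}. ?S P) = (\<Sum>P\<in>{P \<in> lcosets m. P \<subseteq> A}. card (?S P))"
  proof (rule card_UN_disjoint)
    show "\<forall>P\<in>{P \<in> lcosets m. P \<subseteq> A}. \<forall>P'\<in>{P \<in> lcosets m. P \<subseteq> A}. P \<noteq> P' \<longrightarrow> ?S P \<inter> ?S P' = {}"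
    proof (intro ballI impI equals0I)
      fix P P' Q assume "P \<in> {P \<in> lcosets m. P \<subseteq> A}" "P' \<in> {P \<in> lcosets m. P \<subseteq> A}" "P \<noteq> P'"
        and Q: "Q \<in> ?S P \<inter> ?S P'"
      then have "P \<inter> P' = {}" using lcosets_disjoint[of P m P'] by simp
      then have "Q = {}" using Q by blast
      then show False using Q lcosets_nonempty[of Q n] by simp
    qed
  qed (use finite_lcosets in auto)
  ultimately show ?thesis by (simp add: count_def)
qed

text \<open>The index of \<open>V n\<close> in \<open>K\<close>, written as a count so that
  \<open>count_refine\<close> applies to it as well.\<close>

abbreviation ind :: "nat \<Rightarrow> nat" where "ind n \<equiv> count n (carrier K)"

lemma ind_eq: "ind n = card (lcosets n)"
proof -
  have "{Q \<in> lcosets n. Q \<subseteq> carrier K} = lcosets n" using Union_lcosets[of n] by blast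
  then show ?thesis by (simp add: count_def)
qed

lemma ind_pos: "0 < ind n"
  using finite_lcosets[of n] one_closed by (auto simp: ind_eq card_gt_0_iff lcosets_def)

text \<open>Passing from level \<open>m\<close> to a finer level \<open>n\<close> multiplies both
  numerator and denominator by \<open>count n (V m)\<close>.\<close>

lemma count_ratio:
  assumes "saturated m A" "saturated n A"
  shows "real (count m A) / real (ind m) = real (count n A) / real (ind n)"
  using assms
proof (induction m n rule: linorder_wlog)
  case (le m n)
  then show ?case using count_refine[of m A n] count_refine[OF saturated_carrier le(1)] ind_pos[of n]
    by (simp add: field_simps)
qed auto

text \<open>The proportion of cosets lying in \<open>A\<close>. By \<open>count_ratio\<close> the
  chosen level does not matter, and by \<open>clopen_saturated\<close> a suitable level exists for
  every clopen set.\<close>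

definition premeasure :: "'a set \<Rightarrow> real" where
  "premeasure A = (let m = SOME m. saturated m A in real (count m A) / real (ind m))"

lemma premeasure_eq:
  assumes "saturated n A" shows "premeasure A = real (count n A) / real (ind n)"
proof -
  have "saturated (SOME m. saturated m A) A" using assms by (rule someI)
  then show ?thesis unfolding premeasure_def Let_def by (rule count_ratio) (fact assms)
qed

text \<open>At a common level \<open>N\<close> a coset inside the union meets one of the two
  saturated sets and therefore lies in it.\<close>

lemma premeasure_Un:
  assumes "openin T A" "closedin T A" "openin T B" "closedin T B" "A \<inter> B = {}"
  shows "premeasure (A \<union> B) = premeasure A + premeasure B"
proof -
  obtain m n where mn: "saturated m A" "saturated n B" using clopen_saturated assms by meson
  define N where "N = max m n"
  have s: "saturated N A" "saturated N B"
    using saturated_mono[OF mn(1), of N] saturated_mono[OF mn(2), of N] by (auto simp: N_def)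
  then have s3: "saturated N (A \<union> B)" by (auto simp: saturated_def)
  have "{Q \<in> lcosets N. Q \<subseteq> A \<union> B} = {Q \<in> lcosets N. Q \<subseteq> A} \<union> {Q \<in> lcosets N. Q \<subseteq> B}"
  proof -
    have "Q \<subseteq> A \<or> Q \<subseteq> B" if Q: "Q \<in> lcosets N" "Q \<subseteq> A \<union> B" for Q
    proof -
      obtain k where "k \<in> carrier K" "Q = k <# V N" using Q by (auto simp: lcosets_def)
      moreover from this have "k \<in> A \<or> k \<in> B" using lcoset_self[of k N] Q(2) by blast
      ultimately show ?thesis using s by (auto simp: saturated_def)
    qed
    then show ?thesis by blast
  qed
  moreover have "{Q \<in> lcosets N. Q \<subseteq> A} \<inter> {Q \<in> lcosets N. Q \<subseteq> B} = {}"
    using assms(5) lcosets_nonempty[of _ N] by blast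
  ultimately have "count N (A \<union> B) = count N A + count N B"
    unfolding count_def using finite_lcosets by (simp add: card_Un_disjoint)
  then show ?thesis using premeasure_eq[OF s(1)] premeasure_eq[OF s(2)] premeasure_eq[OF s3]
    by (simp add: add_divide_distrib)
qed

lemma premeasure_lcoset:
  assumes "k \<in> carrier K" shows "premeasure (k <# V n) = 1 / real (ind n)"
proof -
  have k: "k <# V n \<in> lcosets n" using assms by (simp add: lcosets_def)
  have "Q = k <# V n" if Q: "Q \<in> lcosets n" "Q \<subseteq> k <# V n" for Q
    using lcosets_disjoint[OF Q(1) k] lcosets_nonempty[OF Q(1)] Q(2) by blast
  then have "{Q \<in> lcosets n. Q \<subseteq> k <# V n} = {k <# V n}" using k by blast
  then show ?thesis using premeasure_eq[OF saturated_lcoset[OF assms]] by (simp add: count_def)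
qed

end

section \<open>Haar measure\<close>

lemma sets_borel_of: "sets (borel_of X) = sigma_sets (topspace X) {U. openin X U}"
  unfolding borel_of_def by (rule sets_measure_of) (auto dest: openin_subset)

lemma space_borel_of: "space (borel_of X) = topspace X"
  by (simp add: borel_of_def space_measure_of_conv)

lemma borel_of_open: "openin X U \<Longrightarrow> U \<in> sets (borel_of X)"
  by (simp add: sets_borel_of sigma_sets.Basic)

lemma borel_of_closed: 
  assumes "closedin X C" shows "C \<in> sets (borel_of X)"
proof -
  have "space (borel_of X) - (topspace X - C) \<in> sets (borel_of X)"
    by (intro sets.compl_sets borel_of_open) (use assms in blast)
  then show ?thesis using closedin_subset[OF assms] by (simp add: space_borel_of double_diff)
qed

lemma continuous_map_borel_measurable:
  assumes "continuous_map X Y f"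
  shows "f \<in> measurable (borel_of X) (borel_of Y)"
proof (rule measurable_sigma_sets)
  show "sets (borel_of Y) = sigma_sets (topspace Y) {U. openin Y U}" by (rule sets_borel_of)
  show "f \<in> space (borel_of X) \<rightarrow> topspace Y"
    using continuous_map_funspace[OF assms] by (simp add: space_borel_of)
  fix U assume "U \<in> {U. openin Y U}"
  then have "openin X {x \<in> topspace X. f x \<in> U}"
    using openin_continuous_map_preimage[OF assms] by simp
  moreover have "{x \<in> topspace X. f x \<in> U} = f -` U \<inter> space (borel_of X)"
    by (auto simp: space_borel_of)
  ultimately show "f -` U \<inter> space (borel_of X) \<in> sets (borel_of X)"
    using borel_of_open by metis
qed (auto dest: openin_subset)

context profinite_group
begin

lemma continuous_translate:
  assumes "k \<in> carrier K" shows "continuous_map T T (\<lambda>x. k \<otimes> x)"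
  using assms by (intro continuous_group_ops) (auto simp: continuous_map_id[unfolded id_def])

text \<open>Translation invariance gives all singletons the same mass, and arbitrarily many of them
  fit into a space of total mass one.\<close>

lemma haar_prob_singleton:
  assumes \<mu>: "haar_prob K T \<mu>" and inf: "infinite (carrier K)" and k: "k \<in> carrier K"
  shows "emeasure \<mu> {k} = 0"
proof -
  have sets: "sets \<mu> = sets (borel_of T)" using \<mu> by (simp add: haar_prob_def)
  have single: "{j} \<in> sets \<mu>" if "j \<in> carrier K" for j
    unfolding sets using that Hausdorff by (intro borel_of_closed) (simp add: topspace closedin_Hausdorff_singleton)
  have eq: "emeasure \<mu> {j} = emeasure \<mu> {k}" if j: "j \<in> carrier K" for j
  proof -
    have "(\<lambda>y. (j \<otimes> inv k) \<otimes> y) -` {j} \<inter> topspace T = {k}"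
    proof -
      have "y = k" if "y \<in> carrier K" "(j \<otimes> inv k) \<otimes> y = j" for y
      proof -
        have "inv k \<otimes> y = \<one>" using that j k by (simp add: m_assoc)
        then show ?thesis using k that by (metis cancel_left(1) r_one)
      qed
      moreover have "(j \<otimes> inv k) \<otimes> k = j" using j k by (simp add: m_assoc)
      ultimately show ?thesis using k by (auto simp: topspace)
    qed
    moreover have "j \<otimes> inv k \<in> carrier K" using j k by simp
    ultimately show ?thesis using \<mu> single[OF j] unfolding haar_prob_def by metis
  qed
  have total: "emeasure \<mu> (carrier K) = 1" using \<mu> by (simp add: haar_prob_def topspace)
  have bound: "of_nat n * emeasure \<mu> {k} \<le> 1" for n
  proof -
    obtain F where F: "F \<subseteq> carrier K" "finite F" "card F = n"
      using infinite_arbitrarily_large[OF inf] by blast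
    have "emeasure \<mu> F = (\<Sum>j\<in>F. emeasure \<mu> {j})"
      using F single by (intro emeasure_eq_sum_singleton) auto
    also have "\<dots> = of_nat n * emeasure \<mu> {k}" using F eq by (simp add: subset_iff)
    finally have "of_nat n * emeasure \<mu> {k} = emeasure \<mu> F" ..
    also have "\<dots> \<le> emeasure \<mu> (carrier K)"
      using F(1) borel_of_open[OF openin_topspace[of T]] by (intro emeasure_mono) (auto simp: sets topspace)
    finally show ?thesis using total by simp
  qed
  \<comment> \<open>The case \<open>n = 1\<close> of the bound excludes infinite mass, so the
    Archimedean property of the reals can be used.\<close>
  obtain r where r: "emeasure \<mu> {k} = ennreal r" "0 \<le> r"
    using bound[of 1] by (cases "emeasure \<mu> {k}") (auto simp: top_unique)
  have "real n * r \<le> 1" for n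
    using bound[of n] r by (simp add: ennreal_of_nat_eq_real_of_nat flip: ennreal_mult)
  then have "\<not> 0 < r" using reals_Archimedean3[of r] by (metis not_less)
  then show ?thesis using r by simp
qed

end

section \<open>Haar measure as the equidistributed measure of a chain\<close>

context profinite_chain
begin

text \<open>There are countably many cosets in all and they form a basis, so every open set is a
  countable union of them. The empty set is added to make the generator stable under
  intersections.\<close>

lemma sets_borel_lcosets:
  "sets (borel_of T) = sigma_sets (carrier K) (insert {} (\<Union>n. lcosets n))" (is "_ = sigma_sets _ ?E")
proof -
  have "sigma_sets (carrier K) ?E \<subseteq> sigma_sets (carrier K) {U. openin T U}"
    by (rule sigma_sets_mono') (auto dest: lcosets_open)
  moreover have "sigma_sets (carrier K) {U. openin T U} \<subseteq> sigma_sets (carrier K) ?E"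
  proof (rule sigma_sets_mono, rule subsetI)
    fix U assume "U \<in> {U. openin T U}"
    then have U: "openin T U" by simp
    have "countable (\<Union>n. lcosets n)" using finite_lcosets by (auto intro: countable_finite)
    then have "countable {Q \<in> (\<Union>n. lcosets n). Q \<subseteq> U}" by (rule countable_subset[rotated]) auto
    then have "\<Union>{Q \<in> (\<Union>n. lcosets n). Q \<subseteq> U} \<in> sigma_sets (carrier K) ?E"
      by (rule sigma_sets_UNION) (auto intro: sigma_sets.Basic)
    moreover have "\<Union>{Q \<in> (\<Union>n. lcosets n). Q \<subseteq> U} = U"
    proof (intro equalityI subsetI)
      fix k assume k: "k \<in> U"
      then have kc: "k \<in> carrier K" using openin_subset[OF U] topspace by auto
      obtain n where "k <# V n \<subseteq> U" using lcoset_basis[OF U k] by auto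
      moreover have "k <# V n \<in> lcosets n" using kc by (simp add: lcosets_def)
      ultimately show "k \<in> \<Union>{Q \<in> (\<Union>n. lcosets n). Q \<subseteq> U}" using lcoset_self[OF kc, of n] by blast
    qed auto
    ultimately show "U \<in> sigma_sets (carrier K) ?E" by simp
  qed
  ultimately show ?thesis by (simp add: sets_borel_of topspace)
qed

lemma lcosets_nested:
  assumes "P \<in> lcosets m" "Q \<in> lcosets n" "m \<le> n" "P \<inter> Q \<noteq> {}"
  shows "Q \<subseteq> P"
proof -
  obtain x where x: "x \<in> P" "x \<in> Q" using assms by blast
  obtain j k where jk: "j \<in> carrier K" "P = j <# V m" "k \<in> carrier K" "Q = k <# V n"
    using assms by (auto simp: lcosets_def)
  then have "P = x <# V m" "Q = x <# V n" using x lcoset_eq[of j x m] lcoset_eq[of k x n] by simp_all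
  then show ?thesis using lcoset_mono[OF assms(3)] by simp
qed

text \<open>Cosets of all levels form a tree: any two are disjoint or nested.\<close>

lemma Int_stable_lcosets: "Int_stable (insert {} (\<Union>n. lcosets n))"
proof -
  have "P \<inter> Q = {} \<or> P \<inter> Q = P \<or> P \<inter> Q = Q" if "P \<in> lcosets m" "Q \<in> lcosets n" for P Q m n
    using lcosets_nested[OF that] lcosets_nested[OF that(2) that(1)] by (cases "m \<le> n") auto
  then have "P \<inter> Q \<in> insert {} (\<Union>n. lcosets n)"
    if PQ: "P \<in> lcosets m" "Q \<in> lcosets n" for P Q m n
    using PQ by (metis UN_I UNIV_I insert_iff)
  then show ?thesis unfolding Int_stable_def by auto
qed

text \<open>Haar measure described through the chain alone. Since the cosets generate the Borel
  sets, prescribing their masses leaves at most one measure.\<close>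

definition equidistributed :: "'a measure \<Rightarrow> bool" where
  "equidistributed M \<longleftrightarrow> sets M = sets (borel_of T) \<and>
     (\<forall>n. \<forall>Q\<in>lcosets n. emeasure M Q = ennreal (1 / real (ind n)))"

lemma lcosets_sets: "Q \<in> lcosets n \<Longrightarrow> Q \<in> sets (borel_of T)"
  by (simp add: borel_of_open lcosets_open)

lemma emeasure_carrier_lcosets:
  assumes "sets M = sets (borel_of T)"
  shows "emeasure M (carrier K) = (\<Sum>Q\<in>lcosets n. emeasure M Q)"
proof -
  have "(\<Sum>Q\<in>lcosets n. emeasure M Q) = emeasure M (\<Union>Q\<in>lcosets n. Q)"
    using lcosets_disjoint finite_lcosets[of n] lcosets_sets assms
    by (intro sum_emeasure) (auto simp: disjoint_family_on_def)
  then show ?thesis using Union_lcosets[of n] by simp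
qed

lemma equidistributed_unique:
  assumes "equidistributed M" "equidistributed N"
  shows "M = N"
proof (rule measure_eqI_generator_eq_countable[where A = "lcosets 0"])
  show "Int_stable (insert {} (\<Union>n. lcosets n))" by (rule Int_stable_lcosets)
  show "insert {} (\<Union>n. lcosets n) \<subseteq> Pow (carrier K)" using Union_lcosets by blast
  show "emeasure M X = emeasure N X" if "X \<in> insert {} (\<Union>n. lcosets n)" for X
    using that assms by (auto simp: equidistributed_def)
  show "sets M = sigma_sets (carrier K) (insert {} (\<Union>n. lcosets n))"
    "sets N = sigma_sets (carrier K) (insert {} (\<Union>n. lcosets n))"
    using assms sets_borel_lcosets by (simp_all add: equidistributed_def)
  show "\<Union>(lcosets 0) = carrier K" by (rule Union_lcosets)
  show "countable (lcosets 0)" using finite_lcosets by (rule countable_finite)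
  show "emeasure M Q \<noteq> \<infinity>" if "Q \<in> lcosets 0" for Q
    using that assms by (auto simp: equidistributed_def)
qed auto

text \<open>Caratheodory extension of \<open>premeasure\<close> from the algebra of clopen sets.
  Continuity at the empty set is a consequence of compactness: a decreasing sequence of clopen sets
  with empty intersection reaches the empty set.\<close>

lemma equidistributed_exists: "\<exists>M. equidistributed M"
proof -
  let ?C = "{A. openin T A \<and> closedin T A}"
  interpret algebra "carrier K" ?C
    unfolding algebra_iff_Un topspace[symmetric] by (auto dest: openin_subset)
  define p where "p A = ennreal (premeasure A)" for A
  have nonneg: "0 \<le> premeasure A" for A by (simp add: premeasure_def Let_def)
  have empty: "premeasure {} = 0"
  proof -
    have "{Q \<in> lcosets 0. Q \<subseteq> {}} = {}" using lcosets_nonempty[of _ 0] by blast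
    then have "count 0 {} = 0" by (simp add: count_def)
    then show ?thesis using premeasure_eq[of 0 "{}"] by (simp add: saturated_def)
  qed
  have "\<exists>\<mu>. (\<forall>A\<in>?C. \<mu> A = p A) \<and> measure_space (carrier K) (sigma_sets (carrier K) ?C) \<mu>"
  proof (rule caratheodory_empty_continuous)
    show "positive ?C p" by (simp add: positive_def p_def empty)
    show "additive ?C p" unfolding additive_def p_def
      using premeasure_Un nonneg by (simp add: ennreal_plus)
    show "p A \<noteq> \<infinity>" for A by (simp add: p_def)
    fix A :: "nat \<Rightarrow> 'a set"
    assume A: "range A \<subseteq> ?C" "decseq A" "(\<Inter>i. A i) = {}"
    have "\<exists>n. A n = {}"
    proof (rule ccontr)
      assume "\<nexists>n. A n = {}"
      then have "(\<Inter>n. A n) \<noteq> {}"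
        using A by (intro compact_space_imp_nest[OF compact]) auto
      then show False using A(3) by simp
    qed
    then obtain n where "A n = {}" ..
    then have "A m = {}" if "n \<le> m" for m using decseqD[OF A(2) that] by simp
    then have "\<forall>\<^sub>F m in sequentially. p (A m) = 0"
      unfolding eventually_sequentially by (auto simp: p_def empty intro!: exI[of _ n])
    then show "(\<lambda>m. p (A m)) \<longlonglongrightarrow> 0" by (rule tendsto_eventually)
  qed
  then obtain \<mu> where \<mu>: "\<And>A. A \<in> ?C \<Longrightarrow> \<mu> A = p A"
    "measure_space (carrier K) (sigma_sets (carrier K) ?C) \<mu>" by blast
  define M where "M = measure_of (carrier K) ?C \<mu>"
  have sets_M: "sets M = sigma_sets (carrier K) ?C"
    unfolding M_def by (rule sets_measure_of) (use space_closed in simp)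
  have "sigma_sets (carrier K) (insert {} (\<Union>n. lcosets n)) \<subseteq> sets M"
    unfolding sets_M by (rule sigma_sets_mono') (auto dest: lcosets_open lcosets_closed)
  moreover have "sets M \<subseteq> sets (borel_of T)"
    unfolding sets_M sets_borel_of topspace by (rule sigma_sets_mono') auto
  ultimately have sets_M': "sets M = sets (borel_of T)" using sets_borel_lcosets by blast
  have "emeasure M Q = ennreal (1 / real (ind n))" if Q: "Q \<in> lcosets n" for n Q
  proof -
    have "emeasure M Q = \<mu> Q"
    proof (rule emeasure_measure_of[OF M_def])
      show "?C \<subseteq> Pow (carrier K)" using space_closed by simp
      show "positive (sets M) \<mu>" "countably_additive (sets M) \<mu>"
        using \<mu>(2) by (auto simp: measure_space_def sets_M)
      show "Q \<in> sets M" using Q lcosets_sets sets_M' by simp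
    qed
    also have "\<dots> = p Q" using \<mu>(1) lcosets_open[OF Q] lcosets_closed[OF Q] by simp
    finally show ?thesis using Q premeasure_lcoset by (auto simp: p_def lcosets_def)
  qed
  then show ?thesis using sets_M' by (auto simp: equidistributed_def)
qed

lemma translate_lcosets:
  assumes "k \<in> carrier K" "Q \<in> lcosets n"
  shows "(\<lambda>x. k \<otimes> x) -` Q \<inter> carrier K \<in> lcosets n"
proof -
  obtain j where j: "j \<in> carrier K" "Q = j <# V n" using assms by (auto simp: lcosets_def)
  have "(\<lambda>x. k \<otimes> x) -` Q \<inter> carrier K = (inv k \<otimes> j) <# V n"
    using assms j by (auto simp: lcoset_iff inv_mult_group m_assoc)
  then show ?thesis using assms j by (simp add: lcosets_def)
qed

text \<open>Every coset of \<open>V n\<close> is open, so it contains some \<open>g\<close> of the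
  dense set \<open>P\<close> and equals \<open>g <# V n\<close>. Invariance under this
  \<open>g\<close> gives it the mass of \<open>V n\<close>, and the total mass one is shared
  equally.\<close>

lemma equidistributedI:
  assumes sets: "sets M = sets (borel_of T)" and total: "emeasure M (carrier K) = 1"
    and P: "P \<subseteq> carrier K" "T closure_of P = topspace T"
    and invariant: "\<And>g A. g \<in> P \<Longrightarrow> A \<in> sets M \<Longrightarrow>
      emeasure M ((\<lambda>y. g \<otimes> y) -` A \<inter> carrier K) = emeasure M A"
  shows "equidistributed M"
proof -
  have V: "emeasure M Q = emeasure M (V n)" if Q: "Q \<in> lcosets n" for Q n
  proof -
    have "Q \<inter> P \<noteq> {}"
      using P(2) lcosets_open[OF Q] lcosets_nonempty[OF Q] openin_subset[OF lcosets_open[OF Q]]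
      by (auto simp: dense_intersects_open)
    then obtain g where g: "g \<in> P" "g \<in> Q" by blast
    then have gc: "g \<in> carrier K" using P(1) by blast
    obtain j where j: "j \<in> carrier K" "Q = j <# V n" using Q by (auto simp: lcosets_def)
    have "Q = g <# V n" using lcoset_eq[OF j(1)] g(2) j(2) by simp
    then have "(\<lambda>y. g \<otimes> y) -` Q \<inter> carrier K = V n"
      using gc subgroup.subset[OF V_subgroup[of n]] by (auto simp: lcoset_iff)
    then show ?thesis using invariant[OF g(1), of Q] lcosets_sets[OF Q] sets by simp
  qed
  have "emeasure M Q = ennreal (1 / real (ind n))" if Q: "Q \<in> lcosets n" for Q n
  proof -
    have "of_nat (ind n) * emeasure M (V n) = 1"
      using emeasure_carrier_lcosets[OF sets, of n] total V[of _ n] by (simp add: ind_eq)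
    moreover from this obtain r where r: "emeasure M (V n) = ennreal r" "0 \<le> r"
      using ind_pos[of n] by (cases "emeasure M (V n)") (auto simp: ennreal_mult_top)
    ultimately have "ennreal (real (ind n) * r) = 1"
      by (simp add: ennreal_of_nat_eq_real_of_nat ennreal_mult)
    then have "real (ind n) * r = 1" using r by (simp add: ennreal_eq_1)
    then have "r = 1 / real (ind n)" using ind_pos[of n] by (simp add: field_simps)
    then show ?thesis using V[OF Q] r by simp
  qed
  then show ?thesis using sets by (simp add: equidistributed_def)
qed

text \<open>Translations permute the cosets of each level, so a translated equidistributed measure
  is again equidistributed and coincides with the original by uniqueness.\<close>

lemma haar_prob_if_equidistributed:
  assumes M: "equidistributed M"
  shows "haar_prob K T M"
proof -
  have sets: "sets M = sets (borel_of T)" using M by (simp add: equidistributed_def)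
  have space: "space M = carrier K" using sets_eq_imp_space_eq[OF sets] by (simp add: space_borel_of topspace)
  have "emeasure M (carrier K) = of_nat (ind 0) * ennreal (1 / real (ind 0))"
    unfolding emeasure_carrier_lcosets[OF sets, of 0]
    using M by (simp add: equidistributed_def ind_eq)
  also have "\<dots> = 1" using ind_pos[of 0]
    by (simp add: ennreal_of_nat_eq_real_of_nat flip: ennreal_mult)
  finally have total: "emeasure M (carrier K) = 1" .
  have "emeasure M ((\<lambda>y. k \<otimes> y) -` A \<inter> topspace T) = emeasure M A"
    if k: "k \<in> carrier K" and A: "A \<in> sets M" for k A
  proof -
    have meas: "(\<lambda>y. k \<otimes> y) \<in> measurable M M"
      using continuous_map_borel_measurable[OF continuous_translate[OF k]] sets
      by (simp cong: measurable_cong_sets)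
    have "emeasure (distr M M (\<lambda>y. k \<otimes> y)) Q = ennreal (1 / real (ind n))" if Q: "Q \<in> lcosets n" for Q n
      using M meas Q translate_lcosets[OF k Q] lcosets_sets[OF Q]
      by (simp add: emeasure_distr equidistributed_def space)
    then have "equidistributed (distr M M (\<lambda>y. k \<otimes> y))" using sets by (simp add: equidistributed_def)
    then have "distr M M (\<lambda>y. k \<otimes> y) = M" using M by (rule equidistributed_unique)
    then have "emeasure M A = emeasure (distr M M (\<lambda>y. k \<otimes> y)) A" by simp
    also have "\<dots> = emeasure M ((\<lambda>y. k \<otimes> y) -` A \<inter> topspace T)"
      using meas A by (simp add: emeasure_distr space topspace)
    finally show ?thesis ..
  qed
  then show ?thesis using sets total by (simp add: haar_prob_def topspace)
qed

end

lemma (in profinite_group) haar_prob_exists: "\<exists>\<mu>. haar_prob K T \<mu>"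
proof -
  obtain V where V: "\<And>n. subgroup (V n) K" "\<And>n. openin T (V n)" "decseq V"
    "\<And>U. openin T U \<Longrightarrow> \<one> \<in> U \<Longrightarrow> \<exists>n. V n \<subseteq> U"
    using open_subgroup_chain by blast
  interpret profinite_chain K T V
    by (intro profinite_chain.intro profinite_group_axioms profinite_chain_axioms.intro V)
  show ?thesis using equidistributed_exists haar_prob_if_equidistributed by blast
qed

text \<open>Invariance is asked only for a dense set because the image in \<open>K\<close> of an
  invariant measure on the subshift is first known to be invariant just under \<open>i(G)\<close>.
  Both measures are equidistributed along one chain.\<close>

lemma (in profinite_group) haar_prob_unique:
  assumes \<mu>: "haar_prob K T \<mu>"
    and sets: "sets M = sets (borel_of T)" and total: "emeasure M (carrier K) = 1"
    and P: "P \<subseteq> carrier K" "T closure_of P = topspace T"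
    and invariant: "\<And>g A. g \<in> P \<Longrightarrow> A \<in> sets M \<Longrightarrow>
      emeasure M ((\<lambda>y. g \<otimes> y) -` A \<inter> carrier K) = emeasure M A"
  shows "M = \<mu>"
proof -
  obtain V where V: "\<And>n. subgroup (V n) K" "\<And>n. openin T (V n)" "decseq V"
    "\<And>U. openin T U \<Longrightarrow> \<one> \<in> U \<Longrightarrow> \<exists>n. V n \<subseteq> U"
    using open_subgroup_chain by blast
  interpret profinite_chain K T V
    by (intro profinite_chain.intro profinite_group_axioms profinite_chain_axioms.intro V)
  have "equidistributed \<mu>"
    using \<mu> P by (intro equidistributedI[of _ P]) (auto simp: haar_prob_def topspace)
  moreover have "equidistributed M" by (rule equidistributedI) fact+
  ultimately show ?thesis using equidistributed_unique by blast
qed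

section \<open>Toeplitz codings\<close>

lemma topspace_full_shift: "topspace (full_shift_top G S) = carrier G \<rightarrow>\<^sub>E S"
  by (simp add: full_shift_top_def)

lemma compact_full_shift: "finite S \<Longrightarrow> compact_space (full_shift_top G S)"
  by (simp add: full_shift_top_def compact_space_product_topology compact_space_discrete_topology)

lemma continuous_full_shift_component:
  "h \<in> carrier G \<Longrightarrow> continuous_map (full_shift_top G S) (discrete_topology S) (\<lambda>x. x h)"
  unfolding full_shift_top_def by (rule continuous_map_product_projection)

lemma shift_apply: "h \<in> carrier G \<Longrightarrow> shift G g x h = x (inv\<^bsub>G\<^esub> g \<otimes>\<^bsub>G\<^esub> h)"
  by (simp add: shift_def)

locale acting_group = group G for G :: "'g monoid" (structure)
begin

lemma shift_shift:
  "g \<in> carrier G \<Longrightarrow> h \<in> carrier G \<Longrightarrow> shift G g (shift G h x) = shift G (g \<otimes> h) x"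
  by (auto simp: shift_def inv_mult_group m_assoc)

lemma shift_one: "x \<in> extensional (carrier G) \<Longrightarrow> shift G \<one> x = x"
  by (auto simp: shift_def extensional_def)

lemma continuous_shift:
  assumes "g \<in> carrier G"
  shows "continuous_map (full_shift_top G S) (full_shift_top G S) (shift G g)"
proof -
  have "continuous_map (full_shift_top G S) (discrete_topology S) (\<lambda>x. shift G g x h)"
    if "h \<in> carrier G" for h
    using that assms continuous_full_shift_component[of "inv g \<otimes> h" G S] by (simp add: shift_apply)
  moreover have "shift G g x \<in> extensional (carrier G)" for x by (simp add: shift_def)
  ultimately show ?thesis
    by (subst (2) full_shift_top_def) (auto simp: continuous_map_componentwise)
qed

lemma orbit_closure_shift:
  assumes g: "g \<in> carrier G" and x: "x \<in> orbit_closure G S \<eta>"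
  shows "shift G g x \<in> orbit_closure G S \<eta>"
proof -
  have "shift G g ` {shift G h \<eta> |h. h \<in> carrier G} \<subseteq> {shift G h \<eta> |h. h \<in> carrier G}"
    using g by (auto simp: shift_shift)
  then have "full_shift_top G S closure_of shift G g ` {shift G h \<eta> |h. h \<in> carrier G}
      \<subseteq> orbit_closure G S \<eta>"
    unfolding orbit_closure_def by (rule closure_of_mono)
  then show ?thesis
    using continuous_map_image_closure_subset[OF continuous_shift[OF g]] x
    unfolding orbit_closure_def by blast
qed

end

text \<open>Finitely many right cosets of the open subgroup \<open>V\<close> cover the compact group
  \<open>K\<close>, and two elements of \<open>G\<close> whose images share a right coset of
  \<open>V\<close> lie in the same right coset of the preimage.\<close>

lemma (in profinite_group) finite_index_vimage:
  fixes G :: "'g monoid"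
  assumes G: "group G" and i: "i \<in> hom G K" and V: "subgroup V K" "openin T V"
  shows "finite_index {h \<in> carrier G. i h \<in> V} G"
proof -
  interpret G: group G by fact
  interpret i: group_hom G K i using i by unfold_locales (auto simp: hom_def)
  define \<Gamma> where "\<Gamma> = {h \<in> carrier G. i h \<in> V}"
  have sub: "subgroup \<Gamma> G"
    using subgroup.one_closed[OF V(1)] subgroup.m_closed[OF V(1)] subgroup.m_inv_closed[OF V(1)]
    by (intro G.subgroupI) (auto simp: \<Gamma>_def)
  \<comment> \<open>This is the right coset of \<open>V\<close> through \<open>j\<close>.\<close>
  define C where "C j = {x \<in> topspace T. x \<otimes> inv j \<in> V}" for j
  have C_open: "openin T (C j)" if "j \<in> carrier K" for j
    unfolding C_def using that
    by (intro openin_continuous_map_preimage[OF _ V(2)] continuous_group_ops)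
      (auto simp: continuous_map_id[unfolded id_def])
  have cover: "topspace T \<subseteq> \<Union>(C ` carrier K)"
    using subgroup.one_closed[OF V(1)] by (auto simp: C_def topspace)
  have "\<exists>\<F>. finite \<F> \<and> \<F> \<subseteq> C ` carrier K \<and> topspace T \<subseteq> \<Union>\<F>"
    using compactinD[OF compact[unfolded compact_space_def], of "C ` carrier K"] C_open cover by auto
  then obtain J where J: "finite J" "J \<subseteq> carrier K" "topspace T \<subseteq> \<Union>(C ` J)"
    unfolding ex_finite_subset_image by blast
  \<comment> \<open>The choice picks one element of \<open>G\<close> landing in each coset
    \<open>C j\<close>. A coset that misses \<open>i(G)\<close> yields an arbitrary element, but the
    argument only visits indices \<open>j\<close> with some \<open>i h\<close> in
    \<open>C j\<close>.\<close>
  have "rcosets\<^bsub>G\<^esub> \<Gamma> \<subseteq> (\<lambda>j. \<Gamma> #>\<^bsub>G\<^esub> (SOME h. h \<in> carrier G \<and> i h \<in> C j)) ` J"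
  proof
    fix Q assume "Q \<in> rcosets\<^bsub>G\<^esub> \<Gamma>"
    then obtain h where h: "h \<in> carrier G" "Q = \<Gamma> #>\<^bsub>G\<^esub> h" by (auto simp: RCOSETS_def)
    then have "i h \<in> topspace T" by (simp add: topspace)
    then obtain j where j: "j \<in> J" "i h \<in> C j" using J(3) by blast
    define h' where "h' = (SOME h. h \<in> carrier G \<and> i h \<in> C j)"
    have h': "h' \<in> carrier G" "i h' \<in> C j"
      using someI[of "\<lambda>h. h \<in> carrier G \<and> i h \<in> C j", OF conjI[OF h(1) j(2)]] by (auto simp: h'_def)
    have jc: "j \<in> carrier K" using j(1) J(2) by blast
    have "(i h' \<otimes> inv j) \<otimes> inv (i h \<otimes> inv j) = i (h' \<otimes>\<^bsub>G\<^esub> inv\<^bsub>G\<^esub> h)"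
      using h h' jc by (simp add: inv_mult_group m_assoc)
    moreover have "(i h' \<otimes> inv j) \<otimes> inv (i h \<otimes> inv j) \<in> V"
      using h'(2) j(2) V(1) by (simp add: C_def subgroup.m_closed subgroup.m_inv_closed)
    ultimately have "h' \<otimes>\<^bsub>G\<^esub> inv\<^bsub>G\<^esub> h \<in> \<Gamma>" using h h' by (simp add: \<Gamma>_def)
    then have "h' \<in> \<Gamma> #>\<^bsub>G\<^esub> h" using h h' G.m_assoc[of h' "inv\<^bsub>G\<^esub> h" h]
      by (auto simp: r_coset_def intro!: bexI[of _ "h' \<otimes>\<^bsub>G\<^esub> inv\<^bsub>G\<^esub> h"])
    then have "Q = \<Gamma> #>\<^bsub>G\<^esub> h'" using G.repr_independence[OF _ h(1) sub] h(2) by simp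
    then show "Q \<in> (\<lambda>j. \<Gamma> #>\<^bsub>G\<^esub> (SOME h. h \<in> carrier G \<and> i h \<in> C j)) ` J"
      using j(1) by (auto simp: h'_def)
  qed
  then have "finite (rcosets\<^bsub>G\<^esub> \<Gamma>)" using J(1) finite_surj by blast
  then show ?thesis using sub by (simp add: finite_index_def \<Gamma>_def)
qed

text \<open>\<open>D\<close> is the set of discontinuities of \<open>f\<close>; the values of \<open>f\<close> on \<open>D\<close> are irrelevant.\<close>

locale toeplitz_coding = profinite_group K T + G: acting_group G
  for K :: "'k monoid" (structure) and T :: "'k topology" and G :: "'g monoid" +
  fixes i :: "'g \<Rightarrow> 'k" and S :: "'s set" and f :: "'k \<Rightarrow> 's" and D :: "'k set"
  assumes hom: "i \<in> hom G K"
    and dense: "T closure_of (i ` carrier G) = topspace T"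
    and countable_G: "countable (carrier G)"
    and countable_D: "countable D"
    and D_carrier: "D \<subseteq> carrier K"
    and D_infinite: "D \<noteq> {} \<Longrightarrow> infinite (carrier K)"
    and D_disjoint: "g \<in> carrier G \<Longrightarrow> i g \<notin> D"
    and finite_S: "finite S"
    and f_range: "f y \<in> S"
    and f_open: "openin T {y \<in> carrier K - D. f y = s}"
    and f_aperiodic: "c \<in> carrier K \<Longrightarrow>
      (\<And>y. y \<in> carrier K - D \<Longrightarrow> c \<otimes> y \<notin> D \<Longrightarrow> f (c \<otimes> y) = f y) \<Longrightarrow> c = \<one>"
begin

sublocale i: group_hom G K i
  using hom by unfold_locales (auto simp: hom_def)

definition \<eta> :: "'g \<Rightarrow> 's" where "\<eta> = (\<lambda>h\<in>carrier G. f (i h))"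

abbreviation FS :: "('g \<Rightarrow> 's) topology" where "FS \<equiv> full_shift_top G S"

definition X :: "('g \<Rightarrow> 's) set" where "X = orbit_closure G S \<eta>"

text \<open>Since \<open>f\<close> is locally constant at \<open>i g\<close>, the elements
  \<open>v\<close> for which \<open>v \<otimes> i g\<close> has the same value contain an open
  subgroup. Its preimage in \<open>G\<close> is a group of periods at \<open>g\<close>.\<close>

lemma toeplitz_\<eta>: "toeplitz_array G S \<eta>"
proof -
  have "\<exists>\<Gamma> \<alpha>. finite_index \<Gamma> G \<and> \<alpha> \<in> S \<and> g \<in> Per G \<eta> \<Gamma> \<alpha>" if g: "g \<in> carrier G" for g
  proof -
    define W where "W = {v \<in> topspace T. v \<otimes> i g \<in> {y \<in> carrier K - D. f y = f (i g)}}"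
    have "openin T W" unfolding W_def using g
      by (intro openin_continuous_map_preimage[OF _ f_open] continuous_group_ops)
        (auto simp: continuous_map_id[unfolded id_def])
    moreover have "\<one> \<in> W" using g D_disjoint by (simp add: W_def topspace)
    ultimately obtain V where V: "subgroup V K" "openin T V" "V \<subseteq> W"
      using open_subgroup_basis by blast
    have "g \<in> Per G \<eta> {h \<in> carrier G. i h \<in> V} (f (i g))"
      using g V(3) by (auto simp: Per_def \<eta>_def W_def)
    then show ?thesis using finite_index_vimage[OF G.group_axioms hom V(1,2)] f_range by blast
  qed
  then show ?thesis using f_range by (auto simp: toeplitz_array_def \<eta>_def)
qed

text \<open>
  The relation \<open>codes\<close> is closed under limits, and it leaves the coordinates that hit \<open>D\<close> free;
  it contains every pair of a point \<open>x\<close> of the orbit closure and its image in \<open>K\<close>.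
\<close>

definition codes :: "'k \<Rightarrow> ('g \<Rightarrow> 's) \<Rightarrow> bool" where
  "codes k x \<longleftrightarrow> k \<in> carrier K \<and> x \<in> carrier G \<rightarrow>\<^sub>E S \<and>
     (\<forall>h\<in>carrier G. inv k \<otimes> i h \<notin> D \<longrightarrow> x h = f (inv k \<otimes> i h))"

text \<open>A pair in the product fails the relation only through a single coordinate
  \<open>h\<close>, where the value \<open>s\<close> is forced but \<open>x h\<close> is another
  symbol. Both conditions are open, the first one because \<open>f\<close> is locally constant off
  \<open>D\<close>.\<close>

lemma codes_closed: "closedin (prod_topology T FS) {p. codes (fst p) (snd p)}"
proof -
  let ?P = "prod_topology T FS"
  define B where "B h s = {p \<in> topspace ?P. inv (fst p) \<otimes> i h \<in> {y \<in> carrier K - D. f y = s}}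
    \<inter> {p \<in> topspace ?P. snd p h \<in> S - {s}}" for h s
  have "openin ?P (B h s)" if h: "h \<in> carrier G" for h s
    unfolding B_def
  proof (rule openin_Int)
    show "openin ?P {p \<in> topspace ?P. inv (fst p) \<otimes> i h \<in> {y \<in> carrier K - D. f y = s}}"
      using h by (intro openin_continuous_map_preimage[OF _ f_open] continuous_group_ops continuous_map_fst) auto
    have "continuous_map ?P (discrete_topology S) (\<lambda>p. snd p h)"
      using continuous_map_compose[OF continuous_map_snd continuous_full_shift_component[OF h]]
      by (simp add: o_def)
    then show "openin ?P {p \<in> topspace ?P. snd p h \<in> S - {s}}"
      by (rule openin_continuous_map_preimage) simp
  qed
  then have B_open: "openin ?P (\<Union>h\<in>carrier G. \<Union>s. B h s)" by blast
  have eq: "{p. codes (fst p) (snd p)} = topspace ?P - (\<Union>h\<in>carrier G. \<Union>s. B h s)"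
  proof (intro Set.set_eqI)
    fix p
    have "codes (fst p) (snd p) \<longleftrightarrow> p \<notin> (\<Union>h\<in>carrier G. \<Union>s. B h s)" if p: "p \<in> topspace ?P"
    proof -
      have "fst p \<in> carrier K" "snd p \<in> carrier G \<rightarrow>\<^sub>E S"
        using p by (auto simp: topspace topspace_full_shift)
      moreover from this have "snd p h \<in> S" "inv (fst p) \<otimes> i h \<in> carrier K" if "h \<in> carrier G" for h
        using that by auto
      ultimately show ?thesis using p by (auto simp: codes_def B_def)
    qed
    moreover have "p \<in> topspace ?P" if "codes (fst p) (snd p)"
      using that by (cases p) (simp add: codes_def topspace topspace_full_shift)
    ultimately show "p \<in> {p. codes (fst p) (snd p)} \<longleftrightarrow> p \<in> topspace ?P - (\<Union>h\<in>carrier G. \<Union>s. B h s)"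
      by blast
  qed
  show ?thesis unfolding eq using closedin_topspace B_open by (rule closedin_diff)
qed

text \<open>If \<open>k\<close> and \<open>k'\<close> both code \<open>x\<close>, then
  \<open>f\<close> agrees with its translate by \<open>inv k' \<otimes> k\<close> wherever both
  arguments avoid \<open>D\<close>, and aperiodicity makes this element trivial.\<close>

lemma codes_unique:
  assumes x: "codes k x" and x': "codes k' x"
  shows "k = k'"
proof -
  have k: "k \<in> carrier K" "k' \<in> carrier K" using assms by (auto simp: codes_def)
  define c where "c = inv k' \<otimes> k"
  have c: "c \<in> carrier K" using k by (simp add: c_def)
  have "c = \<one>"
  proof (rule f_aperiodic[OF c], rule ccontr)
    fix y assume y: "y \<in> carrier K - D" "c \<otimes> y \<notin> D" and ne: "f (c \<otimes> y) \<noteq> f y"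
    \<comment> \<open>On this neighbourhood of \<open>y\<close> both \<open>f\<close> and its
      translate keep their two different values. By density some \<open>inv k \<otimes> i h\<close>
      falls into it, and then \<open>x h\<close> would have both values.\<close>
    define W where "W = {y' \<in> carrier K - D. f y' = f y} \<inter>
      {y' \<in> topspace T. c \<otimes> y' \<in> {z \<in> carrier K - D. f z = f (c \<otimes> y)}}"
    have "openin T W" unfolding W_def
      by (intro openin_Int f_open openin_continuous_map_preimage[OF continuous_translate[OF c]])
    then have "openin T {w \<in> topspace T. inv k \<otimes> w \<in> W}"
      using k by (intro openin_continuous_map_preimage[OF continuous_translate]) auto
    moreover have "y \<in> W" using y c by (simp add: W_def topspace)
    then have "k \<otimes> y \<in> {w \<in> topspace T. inv k \<otimes> w \<in> W}" using k y by (simp add: topspace)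
    ultimately obtain h where h: "h \<in> carrier G" "inv k \<otimes> i h \<in> W"
      using dense unfolding dense_intersects_open by blast
    have "c \<otimes> (inv k \<otimes> i h) = inv k' \<otimes> i h" using k h by (simp add: c_def m_assoc)
    then have "inv k' \<otimes> i h \<notin> D" "f (inv k' \<otimes> i h) = f (c \<otimes> y)"
      "inv k \<otimes> i h \<notin> D" "f (inv k \<otimes> i h) = f y"
      using h(2) by (auto simp: W_def)
    then show False using x x' h(1) ne by (auto simp: codes_def)
  qed
  then have "k' \<otimes> (inv k' \<otimes> k) = k'" using k by (simp add: c_def)
  then show ?thesis using k by simp
qed

lemma codes_shift:
  assumes "codes k x" "g \<in> carrier G"
  shows "codes (i g \<otimes> k) (shift G g x)"
proof -
  have k: "k \<in> carrier K" "x \<in> carrier G \<rightarrow>\<^sub>E S" using assms by (auto simp: codes_def)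
  have "inv (i g \<otimes> k) \<otimes> i h = inv k \<otimes> i (inv\<^bsub>G\<^esub> g \<otimes>\<^bsub>G\<^esub> h)" if "h \<in> carrier G" for h
    using that assms(2) k by (simp add: inv_mult_group m_assoc)
  moreover have "shift G g x \<in> carrier G \<rightarrow>\<^sub>E S"
    using continuous_map_funspace[OF G.continuous_shift[OF assms(2)], of S] k(2)
    unfolding topspace_full_shift by blast
  ultimately show ?thesis using assms k by (simp add: codes_def shift_apply)
qed

lemma codes_\<eta>: "codes \<one> \<eta>"
  using D_disjoint f_range by (auto simp: codes_def \<eta>_def)

lemma codes_orbit: "g \<in> carrier G \<Longrightarrow> codes (i g) (shift G g \<eta>)"
  using codes_shift[OF codes_\<eta>] by simp

lemma X_closed: "closedin FS X"
  by (simp add: X_def orbit_closure_def)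

lemma X_subset: "X \<subseteq> topspace FS"
  using X_closed by (rule closedin_subset)

lemma orbit_X: "g \<in> carrier G \<Longrightarrow> shift G g \<eta> \<in> X"
proof -
  have "{shift G g \<eta> |g. g \<in> carrier G} \<subseteq> topspace FS"
    using codes_orbit unfolding codes_def topspace_full_shift by blast
  then have "{shift G g \<eta> |g. g \<in> carrier G} \<subseteq> X"
    unfolding X_def orbit_closure_def by (rule closure_of_subset)
  then show "g \<in> carrier G \<Longrightarrow> shift G g \<eta> \<in> X" by blast
qed

lemma shift_X: "g \<in> carrier G \<Longrightarrow> x \<in> X \<Longrightarrow> shift G g x \<in> X"
  unfolding X_def by (rule G.orbit_closure_shift)

text \<open>Projection along the compact factor \<open>K\<close> is a closed map. This gives the
  existence of codes on the orbit closure and the continuity of \<open>\<pi>\<close>.\<close>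

lemma codes_preimage_closed:
  assumes "closedin T C"
  shows "closedin FS {x. \<exists>k\<in>C. codes k x}"
proof -
  have "closedin (prod_topology T FS) ({p. codes (fst p) (snd p)} \<inter> C \<times> topspace FS)"
    using assms by (intro closedin_Int codes_closed) (simp add: closedin_prod_Times_iff)
  then have "closedin FS (snd ` ({p. codes (fst p) (snd p)} \<inter> C \<times> topspace FS))"
    using closed_map_snd[OF compact, of FS] by (simp add: closed_map_def)
  moreover have "snd ` ({p. codes (fst p) (snd p)} \<inter> C \<times> topspace FS) = {x. \<exists>k\<in>C. codes k x}"
  proof (intro equalityI subsetI)
    fix x assume "x \<in> {x. \<exists>k\<in>C. codes k x}"
    then obtain k where "k \<in> C" "codes k x" by blast
    then have "(k, x) \<in> {p. codes (fst p) (snd p)} \<inter> C \<times> topspace FS"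
      by (simp add: codes_def topspace_full_shift)
    then show "x \<in> snd ` ({p. codes (fst p) (snd p)} \<inter> C \<times> topspace FS)" by force
  qed auto
  ultimately show ?thesis by simp
qed

text \<open>The other projection is closed because the full shift over a finite alphabet is compact.
  Hence \<open>\<pi>\<close> is a closed map, which is used for its surjectivity and for the
  measurability of its inverse.\<close>

lemma codes_image_closed:
  assumes "closedin FS A"
  shows "closedin T {k. \<exists>x\<in>A. codes k x}"
proof -
  have "closedin (prod_topology T FS) ({p. codes (fst p) (snd p)} \<inter> topspace T \<times> A)"
    using assms by (intro closedin_Int codes_closed) (simp add: closedin_prod_Times_iff)
  then have "closedin T (fst ` ({p. codes (fst p) (snd p)} \<inter> topspace T \<times> A))"
    using closed_map_fst[OF compact_full_shift[OF finite_S, of G], of T] by (simp add: closed_map_def)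
  moreover have "fst ` ({p. codes (fst p) (snd p)} \<inter> topspace T \<times> A) = {k. \<exists>x\<in>A. codes k x}"
  proof (intro equalityI subsetI)
    fix k assume "k \<in> {k. \<exists>x\<in>A. codes k x}"
    then obtain x where "x \<in> A" "codes k x" by blast
    then have "(k, x) \<in> {p. codes (fst p) (snd p)} \<inter> topspace T \<times> A"
      by (simp add: codes_def topspace)
    then show "k \<in> fst ` ({p. codes (fst p) (snd p)} \<inter> topspace T \<times> A)" by force
  qed auto
  ultimately show ?thesis by simp
qed

text \<open>The set of points having a code is closed and contains the orbit of
  \<open>\<eta>\<close>.\<close>

lemma X_codes: assumes "x \<in> X" shows "\<exists>k. codes k x"
proof -
  have "{shift G g \<eta> |g. g \<in> carrier G} \<subseteq> {x. \<exists>k\<in>topspace T. codes k x}"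
    using codes_orbit i.hom_closed by (fastforce simp: topspace)
  then have "X \<subseteq> {x. \<exists>k\<in>topspace T. codes k x}"
    unfolding X_def orbit_closure_def
    by (intro closure_of_minimal codes_preimage_closed closedin_topspace)
  then show ?thesis using assms by blast
qed

section \<open>The factor map and its one-point fibres\<close>

definition \<pi> :: "('g \<Rightarrow> 's) \<Rightarrow> 'k" where "\<pi> x = (THE k. codes k x)"

lemma \<pi>_eq: "codes k x \<Longrightarrow> \<pi> x = k"
  unfolding \<pi>_def using codes_unique by (intro the_equality) auto

lemma codes_\<pi>: "x \<in> X \<Longrightarrow> codes (\<pi> x) x"
  using X_codes \<pi>_eq by metis

lemma \<pi>_carrier: "x \<in> X \<Longrightarrow> \<pi> x \<in> carrier K"
  using codes_\<pi> by (simp add: codes_def)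

lemma \<pi>_continuous: "continuous_map (subtopology FS X) T \<pi>"
  unfolding continuous_map_closedin
proof (intro conjI allI impI)
  show "\<pi> \<in> topspace (subtopology FS X) \<rightarrow> topspace T"
    using \<pi>_carrier by (simp add: topspace)
  fix C assume "closedin T C"
  then have "closedin (subtopology FS X) ({x. \<exists>k\<in>C. codes k x} \<inter> X)"
    using codes_preimage_closed unfolding closedin_subtopology by blast
  moreover have "{x \<in> topspace (subtopology FS X). \<pi> x \<in> C} = {x. \<exists>k\<in>C. codes k x} \<inter> X"
    using X_subset codes_\<pi> \<pi>_eq by auto
  ultimately show "closedin (subtopology FS X) {x \<in> topspace (subtopology FS X). \<pi> x \<in> C}" by simp
qed

lemma \<pi>_image_closed:
  assumes "closedin FS A" "A \<subseteq> X" shows "closedin T (\<pi> ` A)"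
proof -
  have "\<pi> ` A = {k. \<exists>x\<in>A. codes k x}" using assms(2) codes_\<pi> \<pi>_eq by blast
  then show ?thesis using codes_image_closed[OF assms(1)] by simp
qed

text \<open>The image is closed and contains the dense subgroup \<open>i(G)\<close>, since the orbit
  of \<open>\<eta>\<close> is mapped onto it.\<close>

lemma \<pi>_surj: "\<pi> ` X = topspace T"
proof
  show "\<pi> ` X \<subseteq> topspace T" using \<pi>_carrier by (auto simp: topspace)
  have "i ` carrier G \<subseteq> \<pi> ` X"
  proof
    fix k assume "k \<in> i ` carrier G"
    then obtain g where "g \<in> carrier G" "k = i g" by blast
    then have "k = \<pi> (shift G g \<eta>)" "shift G g \<eta> \<in> X"
      using \<pi>_eq[OF codes_orbit] orbit_X by auto
    then show "k \<in> \<pi> ` X" by blast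
  qed
  then have "T closure_of (i ` carrier G) \<subseteq> \<pi> ` X"
    by (rule closure_of_minimal) (rule \<pi>_image_closed[OF X_closed order_refl])
  then show "topspace T \<subseteq> \<pi> ` X" using dense by simp
qed

lemma \<pi>_shift: "g \<in> carrier G \<Longrightarrow> x \<in> X \<Longrightarrow> \<pi> (shift G g x) = i g \<otimes> \<pi> x"
  using \<pi>_eq codes_shift codes_\<pi> by blast

text \<open>For such \<open>k\<close> no coordinate is left free by the coding relation, so the
  fibre is a single point. The complement is the set of products of elements of \<open>i(G)\<close>
  with inverses of elements of \<open>D\<close>.\<close>

definition Y0 :: "'k set" where
  "Y0 = {k \<in> carrier K. \<forall>h\<in>carrier G. inv k \<otimes> i h \<notin> D}"

definition X0 :: "('g \<Rightarrow> 's) set" where "X0 = {x \<in> X. \<pi> x \<in> Y0}"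

definition code :: "'k \<Rightarrow> 'g \<Rightarrow> 's" where
  "code k = (\<lambda>h\<in>carrier G. f (inv k \<otimes> i h))"

lemma codes_Y0: "codes k x \<Longrightarrow> k \<in> Y0 \<Longrightarrow> x = code k"
  by (intro ext) (auto simp: codes_def Y0_def code_def)

text \<open>The fibre over \<open>k\<close> is nonempty by surjectivity, and every point in it has
  all its coordinates forced; this is what places \<open>code k\<close> in the orbit
  closure.\<close>

lemma Y0_code:
  assumes "k \<in> Y0" shows "code k \<in> X" "\<pi> (code k) = k"
proof -
  have "k \<in> \<pi> ` X" using assms \<pi>_surj by (simp add: Y0_def topspace)
  then obtain x where x: "x \<in> X" "\<pi> x = k" by blast
  then have "x = code k" using codes_Y0[OF codes_\<pi>[OF x(1)]] assms by simp
  then show "code k \<in> X" "\<pi> (code k) = k" using x by auto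
qed

lemma X0_code: "x \<in> X0 \<Longrightarrow> code (\<pi> x) = x"
  using codes_Y0[OF codes_\<pi>] by (simp add: X0_def)

lemma code_shift:
  assumes "k \<in> carrier K" "g \<in> carrier G"
  shows "code (i g \<otimes> k) = shift G g (code k)"
  using assms by (auto simp: code_def shift_def inv_mult_group m_assoc)

lemma Y0_translate:
  assumes "k \<in> carrier K" "g \<in> carrier G"
  shows "i g \<otimes> k \<in> Y0 \<longleftrightarrow> k \<in> Y0"
proof -
  have *: "i g \<otimes> k \<in> Y0" if "k \<in> Y0" "g \<in> carrier G" for k g
  proof -
    have "inv (i g \<otimes> k) \<otimes> i h \<notin> D" if h: "h \<in> carrier G" for h
    proof -
      have "inv k \<otimes> i (inv\<^bsub>G\<^esub> g \<otimes>\<^bsub>G\<^esub> h) \<notin> D"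
        using \<open>k \<in> Y0\<close> \<open>g \<in> carrier G\<close> h unfolding Y0_def by blast
      then show ?thesis
        using \<open>k \<in> Y0\<close> \<open>g \<in> carrier G\<close> h by (simp add: Y0_def inv_mult_group m_assoc)
    qed
    then show ?thesis using that by (simp add: Y0_def)
  qed
  \<comment> \<open>The converse is the same implication for the inverse of
    \<open>g\<close>.\<close>
  show ?thesis using *[of k g] *[of "i g \<otimes> k" "inv\<^bsub>G\<^esub> g"] assms by auto
qed

lemma almost_one_one: "almost_one_one_factor G S X K T i \<pi>"
proof -
  \<comment> \<open>The identity is the point with a single preimage: the elements to be tested are
    those of \<open>i(G)\<close>, and \<open>i(G)\<close> avoids \<open>D\<close>.\<close>
  have "\<one> \<in> Y0" using D_disjoint by (simp add: Y0_def)
  then have "\<exists>!x. x \<in> X \<and> \<pi> x = \<one>"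
    using Y0_code[of \<one>] codes_Y0 codes_\<pi> by metis
  then have "\<exists>y\<in>topspace T. \<exists>!x. x \<in> X \<and> \<pi> x = y" by (auto simp: topspace)
  then show ?thesis
    using \<pi>_continuous \<pi>_surj \<pi>_shift by (simp add: almost_one_one_factor_def)
qed

end

lemma (in profinite_group) countable_null_set:
  assumes \<mu>: "haar_prob K T \<mu>" and inf: "infinite (carrier K)"
    and A: "countable A" "A \<subseteq> carrier K"
  shows "A \<in> null_sets \<mu>"
proof -
  have "{k} \<in> null_sets \<mu>" if "k \<in> A" for k
  proof
    have k: "k \<in> carrier K" using that A(2) by blast
    then show "emeasure \<mu> {k} = 0" by (rule haar_prob_singleton[OF \<mu> inf])
    have "closedin T {k}" using k Hausdorff by (simp add: topspace closedin_Hausdorff_singleton)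
    then show "{k} \<in> sets \<mu>" using \<mu> borel_of_closed by (simp add: haar_prob_def)
  qed
  then have "(\<Union>k\<in>A. {k}) \<in> null_sets \<mu>" using A(1) by (intro null_sets_UN') auto
  then show ?thesis by simp
qed

section \<open>Invariant measures, unique ergodicity and the conjugacy\<close>

context toeplitz_coding
begin

abbreviation BX :: "('g \<Rightarrow> 's) measure" where "BX \<equiv> borel_of (subtopology FS X)"

lemma space_BX: "space BX = X"
  using X_subset by (auto simp: space_borel_of)

lemma sets_haar: "haar_prob K T \<mu> \<Longrightarrow> sets \<mu> = sets (borel_of T)"
  by (simp add: haar_prob_def)

lemma space_haar: "haar_prob K T \<mu> \<Longrightarrow> space \<mu> = carrier K"
  using sets_eq_imp_space_eq[OF sets_haar] by (simp add: space_borel_of topspace)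

text \<open>The complement is parametrized by pairs from \<open>G\<close> and \<open>D\<close>,
  hence countable. If \<open>D\<close> is nonempty then \<open>K\<close> is infinite and countable
  sets are null; otherwise the complement is empty.\<close>

lemma Y0_conull:
  assumes "haar_prob K T \<mu>"
  shows "carrier K - Y0 \<in> null_sets \<mu>"
proof (cases "D = {}")
  case True
  have "carrier K - Y0 = {}" unfolding Y0_def by (simp add: True)
  then show ?thesis by (simp only: null_sets.empty_sets)
next
  case False
  have "carrier K - Y0 \<subseteq> (\<lambda>(h, d). i h \<otimes> inv d) ` (carrier G \<times> D)"
  proof
    fix k assume "k \<in> carrier K - Y0"
    then obtain h where h: "k \<in> carrier K" "h \<in> carrier G" "inv k \<otimes> i h \<in> D" by (auto simp: Y0_def)
    have "i h \<otimes> inv (inv k \<otimes> i h) = k" using h by (simp add: inv_mult_group)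
    then show "k \<in> (\<lambda>(h, d). i h \<otimes> inv d) ` (carrier G \<times> D)" using h by force
  qed
  then have "countable (carrier K - Y0)"
    by (rule countable_subset) (intro countable_image countable_SIGMA countable_G countable_D)
  then show ?thesis using countable_null_set[OF assms D_infinite[OF False]] by simp
qed

text \<open>Measurability is read off from the complement being a null set of a Haar
  measure.\<close>

lemma Y0_sets: "Y0 \<in> sets (borel_of T)"
proof -
  obtain \<mu> where \<mu>: "haar_prob K T \<mu>" using haar_prob_exists by blast
  have "carrier K - (carrier K - Y0) \<in> sets \<mu>"
    using Y0_conull[OF \<mu>] space_haar[OF \<mu>] sets.compl_sets[of "carrier K - Y0" \<mu>] by auto
  moreover have "carrier K - (carrier K - Y0) = Y0" by (auto simp: Y0_def)
  ultimately show ?thesis by (simp add: sets_haar[OF \<mu>])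
qed

lemma \<pi>_measurable: "\<pi> \<in> measurable BX (borel_of T)"
  using \<pi>_continuous by (rule continuous_map_borel_measurable)

lemma shift_measurable: 
  assumes "g \<in> carrier G" shows "shift G g \<in> measurable BX BX"
proof (rule continuous_map_borel_measurable)
  show "continuous_map (subtopology FS X) (subtopology FS X) (shift G g)"
    using G.continuous_shift[OF assms] shift_X[OF assms] X_subset
    by (auto simp: continuous_map_in_subtopology intro: continuous_map_from_subtopology)
qed

lemma X0_sets: "X0 \<in> sets BX"
proof -
  have "X0 = \<pi> -` Y0 \<inter> space BX" by (auto simp: X0_def space_BX)
  then show ?thesis using measurable_sets[OF \<pi>_measurable Y0_sets] by simp
qed

text \<open>For \<open>k\<close> in \<open>Y0\<close> the fibre is the single point
  \<open>code k\<close>, so this point lies in an open set \<open>W\<close> exactly when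
  \<open>k\<close> avoids the image under \<open>\<pi>\<close> of the closed set
  \<open>X - W\<close>. That image is closed.\<close>

lemma code_measurable: "code \<in> measurable (restrict_space (borel_of T) Y0) BX"
proof (rule measurable_sigma_sets[OF sets_borel_of])
  have space: "space (restrict_space (borel_of T) Y0) = Y0"
    by (auto simp: space_restrict_space space_borel_of topspace Y0_def)
  show "code \<in> space (restrict_space (borel_of T) Y0) \<rightarrow> topspace (subtopology FS X)"
    using Y0_code(1) X_subset by (auto simp: space)
  fix U assume "U \<in> {U. openin (subtopology FS X) U}"
  then obtain W where W: "openin FS W" "U = W \<inter> X" by (auto simp: openin_subtopology)
  have "closedin FS (X - W)" using X_closed W(1) by (rule closedin_diff)
  then have "\<pi> ` (X - W) \<in> sets (borel_of T)" by (intro borel_of_closed \<pi>_image_closed) auto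
  then have "topspace T - \<pi> ` (X - W) \<in> sets (borel_of T)"
    using sets.compl_sets[of "\<pi> ` (X - W)" "borel_of T"] by (simp add: space_borel_of)
  moreover have "code -` U \<inter> Y0 = Y0 \<inter> (topspace T - \<pi> ` (X - W))"
  proof (intro equalityI subsetI)
    fix k assume k: "k \<in> code -` U \<inter> Y0"
    have "k \<notin> \<pi> ` (X - W)"
    proof
      assume "k \<in> \<pi> ` (X - W)"
      then obtain x where "x \<in> X" "x \<notin> W" "k = \<pi> x" by blast
      then show False using k X0_code[of x] W(2) by (auto simp: X0_def)
    qed
    then show "k \<in> Y0 \<inter> (topspace T - \<pi> ` (X - W))" using k by (auto simp: Y0_def topspace)
  next
    fix k assume k: "k \<in> Y0 \<inter> (topspace T - \<pi> ` (X - W))"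
    then have "code k \<in> X" "\<pi> (code k) = k" using Y0_code by auto
    moreover from this have "code k \<in> W" using k by (metis DiffI DiffD2 IntD2 image_eqI)
    ultimately show "k \<in> code -` U \<inter> Y0" using k W(2) by simp
  qed
  ultimately show "code -` U \<inter> space (restrict_space (borel_of T) Y0) \<in> sets (restrict_space (borel_of T) Y0)"
    by (auto simp: space sets_restrict_space)
qed (use openin_subset in blast)

lemma code_preimage_sets:
  assumes "A \<in> sets BX" shows "{k \<in> Y0. code k \<in> A} \<in> sets (borel_of T)"
proof -
  have "code -` A \<inter> space (restrict_space (borel_of T) Y0) \<in> sets (restrict_space (borel_of T) Y0)"
    using code_measurable assms by (rule measurable_sets)
  moreover have "code -` A \<inter> space (restrict_space (borel_of T) Y0) = {k \<in> Y0. code k \<in> A}"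
    by (auto simp: space_restrict_space space_borel_of topspace Y0_def)
  moreover have "Y0 \<inter> space (borel_of T) \<in> sets (borel_of T)" using Y0_sets by auto
  ultimately show ?thesis by (simp add: sets_restrict_space_iff)
qed

lemma sets_invariant: "invariant_prob G S X \<nu> \<Longrightarrow> sets \<nu> = sets BX"
  by (simp add: invariant_prob_def)

lemma space_invariant: "invariant_prob G S X \<nu> \<Longrightarrow> space \<nu> = X"
  using sets_eq_imp_space_eq[OF sets_invariant] space_BX by simp

text \<open>Equivariance of \<open>\<pi>\<close> makes the image measure invariant under the dense
  subgroup \<open>i(G)\<close>, and this already characterizes Haar measure.\<close>

lemma distr_\<pi>:
  assumes \<nu>: "invariant_prob G S X \<nu>" and \<mu>: "haar_prob K T \<mu>"
  shows "distr \<nu> (borel_of T) \<pi> = \<mu>"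
proof (rule haar_prob_unique[OF \<mu>, of _ "i ` carrier G"])
  have \<pi>: "\<pi> \<in> measurable \<nu> (borel_of T)"
    using \<pi>_measurable sets_invariant[OF \<nu>] by (simp cong: measurable_cong_sets)
  have em: "emeasure (distr \<nu> (borel_of T) \<pi>) A = emeasure \<nu> (\<pi> -` A \<inter> X)"
    if "A \<in> sets (borel_of T)" for A
    using that by (simp add: emeasure_distr[OF \<pi>] space_invariant[OF \<nu>])
  show "sets (distr \<nu> (borel_of T) \<pi>) = sets (borel_of T)" by simp
  have "\<pi> -` carrier K \<inter> X = X" using \<pi>_carrier by auto
  then show "emeasure (distr \<nu> (borel_of T) \<pi>) (carrier K) = 1"
    using em[of "carrier K"] borel_of_open[OF openin_topspace, of T] \<nu> by (simp add: topspace invariant_prob_def)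
  show "i ` carrier G \<subseteq> carrier K" by auto
  show "T closure_of i ` carrier G = topspace T" by (rule dense)
  fix k A assume "k \<in> i ` carrier G" and A: "A \<in> sets (distr \<nu> (borel_of T) \<pi>)"
  then obtain g where g: "g \<in> carrier G" "k = i g" by blast
  let ?B = "(\<lambda>y. k \<otimes> y) -` A \<inter> carrier K"
  have "(\<lambda>y. k \<otimes> y) -` A \<inter> space (borel_of T) \<in> sets (borel_of T)"
    using A g continuous_map_borel_measurable[OF continuous_translate[of k]]
    by (intro measurable_sets[of _ "borel_of T" "borel_of T"]) auto
  then have B: "?B \<in> sets (borel_of T)" by (simp add: space_borel_of topspace)
  have "\<pi> -` ?B \<inter> X = shift G g -` (\<pi> -` A \<inter> X) \<inter> X"
    using \<pi>_carrier \<pi>_shift[OF g(1)] shift_X[OF g(1)] g(2) by auto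
  moreover have "\<pi> -` A \<inter> X \<in> sets \<nu>"
    using measurable_sets[OF \<pi>, of A] A by (simp add: space_invariant[OF \<nu>])
  then have "emeasure \<nu> (shift G g -` (\<pi> -` A \<inter> X) \<inter> X) = emeasure \<nu> (\<pi> -` A \<inter> X)"
    using \<nu> g(1) unfolding invariant_prob_def by blast
  ultimately show "emeasure (distr \<nu> (borel_of T) \<pi>) ?B = emeasure (distr \<nu> (borel_of T) \<pi>) A"
    using em[OF B] em[of A] A by (simp only: sets_distr)
qed

lemma emeasure_invariant_prob:
  assumes \<nu>: "invariant_prob G S X \<nu>" and \<mu>: "haar_prob K T \<mu>" and A: "A \<in> sets (borel_of T)"
  shows "emeasure \<nu> (\<pi> -` A \<inter> X) = emeasure \<mu> A"
proof -
  have \<pi>: "\<pi> \<in> measurable \<nu> (borel_of T)"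
    using \<pi>_measurable sets_invariant[OF \<nu>] by (simp cong: measurable_cong_sets)
  show ?thesis
    using A by (simp add: distr_\<pi>[OF \<nu> \<mu>, symmetric] emeasure_distr[OF \<pi>] space_invariant[OF \<nu>])
qed

lemma X0_conull:
  assumes \<nu>: "invariant_prob G S X \<nu>"
  shows "X - X0 \<in> null_sets \<nu>"
proof (rule null_setsI)
  obtain \<mu> where \<mu>: "haar_prob K T \<mu>" using haar_prob_exists by blast
  have eq: "X - X0 = \<pi> -` (carrier K - Y0) \<inter> X" using \<pi>_carrier by (auto simp: X0_def)
  show "emeasure \<nu> (X - X0) = 0"
    unfolding eq using emeasure_invariant_prob[OF \<nu> \<mu>, of "carrier K - Y0"] Y0_conull[OF \<mu>]
    by (auto simp: null_sets_def sets_haar[OF \<mu>])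
  show "X - X0 \<in> sets \<nu>"
    using X0_sets sets.compl_sets[of X0 \<nu>] by (simp add: space_invariant[OF \<nu>] sets_invariant[OF \<nu>])
qed

text \<open>Up to the null set \<open>X - X0\<close>, the set \<open>A\<close> is the preimage of a
  Borel set of \<open>K\<close>. The right-hand side does not involve \<open>\<nu>\<close>, which
  gives uniqueness.\<close>

lemma emeasure_invariant_prob_code:
  assumes \<nu>: "invariant_prob G S X \<nu>" and \<mu>: "haar_prob K T \<mu>" and A: "A \<in> sets BX"
  shows "emeasure \<nu> A = emeasure \<mu> {k \<in> Y0. code k \<in> A}"
proof -
  have "\<pi> -` {k \<in> Y0. code k \<in> A} \<inter> X = A - (X - X0)"
    using X0_code sets.sets_into_space[OF A] by (auto simp: X0_def space_BX)
  moreover have "emeasure \<nu> (A - (X - X0)) = emeasure \<nu> A"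
    using X0_conull[OF \<nu>] A by (intro emeasure_Diff_null_set) (auto simp: sets_invariant[OF \<nu>])
  ultimately show ?thesis using emeasure_invariant_prob[OF \<nu> \<mu> code_preimage_sets[OF A]] by simp
qed

text \<open>Haar measure on the conull set \<open>Y0\<close> is pushed forward by
  \<open>code\<close>. Invariance carries over because \<open>Y0\<close> is stable under
  \<open>i(G)\<close> and \<open>code\<close> is equivariant.\<close>

lemma invariant_prob_exists: "\<exists>\<nu>. invariant_prob G S X \<nu>"
proof -
  obtain \<mu> where \<mu>: "haar_prob K T \<mu>" using haar_prob_exists by blast
  define \<nu> where "\<nu> = distr (restrict_space \<mu> Y0) BX code"
  have Y0: "Y0 \<in> sets \<mu>" "Y0 \<subseteq> carrier K" "Y0 \<inter> space \<mu> \<in> sets \<mu>"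
    using Y0_sets sets.Int_space_eq2[of Y0 \<mu>] unfolding sets_haar[OF \<mu>] by (auto simp: Y0_def)
  have meas: "code \<in> measurable (restrict_space \<mu> Y0) BX"
    using code_measurable sets_restrict_space_cong[OF sets_haar[OF \<mu>], of Y0]
    by (simp cong: measurable_cong_sets)
  have em: "emeasure \<nu> A = emeasure \<mu> {k \<in> Y0. code k \<in> A}" if A: "A \<in> sets BX" for A
  proof -
    have "code -` A \<inter> space (restrict_space \<mu> Y0) = {k \<in> Y0. code k \<in> A}"
      using Y0(2) by (auto simp: space_restrict_space space_haar[OF \<mu>])
    then show ?thesis unfolding \<nu>_def
      using Y0 emeasure_distr[OF meas A] emeasure_restrict_space[of Y0 \<mu> "{k \<in> Y0. code k \<in> A}"]
      by (simp add: subset_iff)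
  qed
  have "emeasure \<nu> X = emeasure \<mu> {k \<in> Y0. code k \<in> X}"
    using sets.top[of BX] by (intro em) (simp add: space_BX)
  \<comment> \<open>The double complement presents \<open>Y0\<close> as \<open>K\<close> minus a
    null set, so its mass is the total mass one.\<close>
  also have "{k \<in> Y0. code k \<in> X} = carrier K - (carrier K - Y0)" using Y0_code(1) Y0(2) by auto
  also have "emeasure \<mu> \<dots> = emeasure \<mu> (carrier K)"
    using Y0_conull[OF \<mu>] sets.top[of \<mu>] by (intro emeasure_Diff_null_set) (auto simp: space_haar[OF \<mu>])
  also have "\<dots> = 1" using \<mu> by (simp add: haar_prob_def topspace)
  finally have "emeasure \<nu> X = 1" .
  moreover have "emeasure \<nu> (shift G g -` A \<inter> X) = emeasure \<nu> A"
    if g: "g \<in> carrier G" and A: "A \<in> sets \<nu>" for g A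
  proof -
    have A': "A \<in> sets BX" using A by (simp add: \<nu>_def)
    have B: "shift G g -` A \<inter> X \<in> sets BX"
      using measurable_sets[OF shift_measurable[OF g] A'] by (simp add: space_BX)
    have "{k \<in> Y0. code k \<in> shift G g -` A \<inter> X}
        = (\<lambda>y. i g \<otimes> y) -` {k \<in> Y0. code k \<in> A} \<inter> topspace T"
      using Y0(2) Y0_translate[OF _ g] code_shift[OF _ g] Y0_code(1) by (auto simp: topspace)
    moreover have "emeasure \<mu> ((\<lambda>y. i g \<otimes> y) -` {k \<in> Y0. code k \<in> A} \<inter> topspace T)
        = emeasure \<mu> {k \<in> Y0. code k \<in> A}"
      using \<mu> i.hom_closed[OF g] code_preimage_sets[OF A'] unfolding haar_prob_def by blast
    ultimately show ?thesis by (simp add: em[OF A'] em[OF B])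
  qed
  moreover have "sets \<nu> = sets BX" by (simp add: \<nu>_def)
  ultimately show ?thesis unfolding invariant_prob_def by blast
qed

lemma uniquely_ergodic: "uniquely_ergodic G S X"
proof -
  obtain \<mu> where \<mu>: "haar_prob K T \<mu>" using haar_prob_exists by blast
  have "\<nu> = \<nu>'" if "invariant_prob G S X \<nu>" "invariant_prob G S X \<nu>'" for \<nu> \<nu>'
    using that emeasure_invariant_prob_code[OF _ \<mu>] by (intro measure_eqI) (auto simp: sets_invariant)
  then show ?thesis using invariant_prob_exists unfolding uniquely_ergodic_def by blast
qed

lemma bij_\<pi>: "bij_betw \<pi> X0 Y0"
  by (rule bij_betw_byWitness[where f' = code]) (use X0_code Y0_code in \<open>auto simp: X0_def\<close>)

lemma shift_X0: 
  assumes g: "g \<in> carrier G" shows "shift G g ` X0 = X0"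
proof
  have sub: "shift G h x \<in> X0" if "h \<in> carrier G" "x \<in> X0" for h x
    using that shift_X \<pi>_shift Y0_translate \<pi>_carrier by (auto simp: X0_def)
  then show "shift G g ` X0 \<subseteq> X0" using g by blast
  show "X0 \<subseteq> shift G g ` X0"
  proof
    fix x assume x: "x \<in> X0"
    then have "x \<in> extensional (carrier G)"
      using X_subset by (auto simp: X0_def topspace_full_shift PiE_def)
    then have "shift G g (shift G (inv\<^bsub>G\<^esub> g) x) = x" using g by (simp add: G.shift_shift G.shift_one)
    moreover have "shift G (inv\<^bsub>G\<^esub> g) x \<in> X0" using sub g x by simp
    ultimately show "x \<in> shift G g ` X0" by (metis image_eqI)
  qed
qed

lemma translate_Y0:
  assumes g: "g \<in> carrier G" shows "(\<lambda>y. i g \<otimes> y) ` Y0 = Y0"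
proof
  have sub: "i h \<otimes> k \<in> Y0" if "h \<in> carrier G" "k \<in> Y0" for h k
    using that Y0_translate by (simp add: Y0_def)
  then show "(\<lambda>y. i g \<otimes> y) ` Y0 \<subseteq> Y0" using g by blast
  show "Y0 \<subseteq> (\<lambda>y. i g \<otimes> y) ` Y0"
  proof
    fix k assume k: "k \<in> Y0"
    then have "i g \<otimes> (inv (i g) \<otimes> k) = k" using g by (simp add: Y0_def)
    moreover have "inv (i g) \<otimes> k \<in> Y0" using sub[of "inv\<^bsub>G\<^esub> g"] g k by simp
    ultimately show "k \<in> (\<lambda>y. i g \<otimes> y) ` Y0" by (metis image_eqI)
  qed
qed

lemma measure_conjugacy_\<pi>:
  assumes \<nu>: "invariant_prob G S X \<nu>" and \<mu>: "haar_prob K T \<mu>"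
  shows "measure_conjugacy \<nu> \<mu> (shift G) (\<lambda>g y. i g \<otimes> y) (carrier G) \<pi>"
  unfolding measure_conjugacy_def
proof (intro exI[of _ X0] exI[of _ Y0] conjI ballI impI)
  show "X0 \<in> sets \<nu>" using X0_sets sets_invariant[OF \<nu>] by simp
  show "Y0 \<in> sets \<mu>" using Y0_sets sets_haar[OF \<mu>] by simp
  show "emeasure \<nu> (space \<nu> - X0) = 0" "emeasure \<mu> (space \<mu> - Y0) = 0"
    using X0_conull[OF \<nu>] Y0_conull[OF \<mu>] space_invariant[OF \<nu>] space_haar[OF \<mu>] by auto
  have "\<pi> \<in> measurable \<nu> \<mu>"
    using \<pi>_measurable sets_invariant[OF \<nu>] sets_haar[OF \<mu>] by (simp cong: measurable_cong_sets)
  then show "\<pi> \<in> measurable (restrict_space \<nu> X0) (restrict_space \<mu> Y0)"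
    by (intro measurable_restrict_space2 measurable_restrict_space1)
      (auto simp: space_restrict_space X0_def)
  have "code \<in> measurable (restrict_space \<mu> Y0) \<nu>"
    using code_measurable sets_restrict_space_cong[OF sets_haar[OF \<mu>], of Y0] sets_invariant[OF \<nu>]
    by (simp cong: measurable_cong_sets)
  then have "code \<in> measurable (restrict_space \<mu> Y0) (restrict_space \<nu> X0)"
    using Y0_code by (intro measurable_restrict_space2) (auto simp: space_restrict_space X0_def)
  \<comment> \<open>The inverse coincides on \<open>Y0\<close> with \<open>code\<close>, whose
    measurability is known.\<close>
  moreover have "the_inv_into X0 \<pi> k = code k" if "k \<in> Y0" for k
    using that Y0_code[OF that] bij_\<pi> by (intro the_inv_into_f_eq) (auto simp: X0_def bij_betw_def)
  ultimately show "the_inv_into X0 \<pi> \<in> measurable (restrict_space \<mu> Y0) (restrict_space \<nu> X0)"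
    by (subst measurable_cong[of _ _ code]) (auto simp: space_restrict_space)
  fix A assume A: "A \<in> sets \<mu>" "A \<subseteq> Y0"
  then have "\<pi> -` A \<inter> X0 = \<pi> -` A \<inter> X" by (auto simp: X0_def)
  then show "emeasure \<nu> (\<pi> -` A \<inter> X0) = emeasure \<mu> A"
    using A emeasure_invariant_prob[OF \<nu> \<mu>] sets_haar[OF \<mu>] by simp
qed (use shift_X0 translate_Y0 bij_\<pi> \<pi>_shift in \<open>auto simp: X0_def\<close>)

end

section \<open>Construction of the coding function\<close>

context profinite_chain
begin

text \<open>No \<open>V n\<close> is trivial, since otherwise its finitely many cosets would be
  singletons covering an infinite group. A nontrivial element of \<open>V n\<close> is excluded by
  some later subgroup, and \<open>n \<le> r n\<close> keeps the subchain cofinal.\<close>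

lemma strict_subchain:
  assumes inf: "infinite (carrier K)"
  obtains r :: "nat \<Rightarrow> nat" where "\<And>n. n \<le> r n" "\<And>n. V (r (Suc n)) \<subset> V (r n)"
proof -
  have step: "\<exists>m>n. V m \<subset> V n" for n
  proof -
    have "V n \<noteq> {\<one>}"
    proof
      assume one: "V n = {\<one>}"
      have "carrier K \<subseteq> (\<lambda>P. the_elem P) ` lcosets n"
      proof
        fix k assume k: "k \<in> carrier K"
        then have "k = the_elem (k <# V n)" by (simp add: one l_coset_def)
        then show "k \<in> (\<lambda>P. the_elem P) ` lcosets n" using k by (auto simp: lcosets_def)
      qed
      then show False using inf finite_lcosets finite_surj by blast
    qed
    then obtain x where x: "x \<in> V n" "x \<noteq> \<one>" using subgroup.one_closed[OF V_subgroup] by blast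
    then have "x \<in> carrier K" using subgroup.mem_carrier[OF V_subgroup] by blast
    then have "openin T (topspace T - {x})"
      using Hausdorff by (intro openin_diff openin_topspace) (simp add: topspace closedin_Hausdorff_singleton)
    then obtain m where m: "V m \<subseteq> topspace T - {x}" using V_basis x(2) by (auto simp: topspace)
    \<comment> \<open>The index must be at least \<open>m\<close> to lose \<open>x\<close> and
      larger than \<open>n\<close> for the recursion to keep \<open>n \<le> r n\<close>.\<close>
    have "V (max (Suc n) m) \<subseteq> V n" "V (max (Suc n) m) \<subseteq> V m" using V_dec by (auto simp: decseq_def)
    then have "V (max (Suc n) m) \<subset> V n" using m x(1) by blast
    then show ?thesis by (intro exI[of _ "max (Suc n) m"]) simp
  qed
  have "\<exists>r. \<forall>n. n \<le> r n \<and> V (r (Suc n)) \<subset> V (r n)"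
  proof (rule dependent_nat_choice[where P = "\<lambda>n m. n \<le> m" and Q = "\<lambda>n m m'. V m' \<subset> V m"])
    fix m n :: nat assume "n \<le> m"
    moreover obtain m' where "m < m'" "V m' \<subset> V m" using step by blast
    ultimately show "\<exists>m'. Suc n \<le> m' \<and> V m' \<subset> V m" by (intro exI[of _ m']) simp
  qed simp
  then show thesis using that by blast
qed

lemma discontinuity_chain:
  assumes inf: "infinite (carrier K)" and z: "z \<in> carrier K"
  obtains f :: "'a \<Rightarrow> nat"
  where "\<And>y. f y \<in> {0, 1}" "\<And>s. openin T {y \<in> carrier K - {z}. f y = s}"
    "\<And>U s. openin T U \<Longrightarrow> z \<in> U \<Longrightarrow> s \<in> {0, 1} \<Longrightarrow> \<exists>y\<in>U - {z}. f y = s"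
proof -
  obtain r where r: "\<And>n. n \<le> r n" "\<And>n. V (r (Suc n)) \<subset> V (r n)" using strict_subchain[OF inf] by blast
  define B where "B n = z <# V (r n)" for n
  have Vr_dec: "V (r n) \<subseteq> V (r m)" if "m \<le> n" for m n
    using decseq_SucI[of "\<lambda>n. V (r n)"] r(2) that by (auto simp: decseq_def)
  have B_dec: "B n \<subseteq> B m" if "m \<le> n" for m n
    using Vr_dec[OF that] by (auto simp: B_def l_coset_def)
  have B_sub: "B n \<subseteq> z <# V n" for n
    unfolding B_def using r(1) by (rule lcoset_mono)
  \<comment> \<open>The depth of \<open>y\<close> in the chain of cosets around \<open>z\<close>. At
    \<open>z\<close>, which lies in every \<open>B n\<close>, the value is unspecified, but its
    parity is still 0 or 1.\<close>
  define N where "N y = (LEAST n. y \<notin> B n)" for y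
  have B_lt: "y \<in> B n" if "n < N y" for y n using not_less_Least that unfolding N_def by blast
  have B_N: "y \<notin> B (N y)" if y: "y \<in> carrier K" "y \<noteq> z" for y
  proof -
    have "openin T (topspace T - {y})" using y(1)
      using Hausdorff by (intro openin_diff openin_topspace) (simp add: topspace closedin_Hausdorff_singleton)
    then obtain n where "z <# V n \<subseteq> topspace T - {y}" using lcoset_basis[of _ z] y(2) z by (auto simp: topspace)
    then have "y \<notin> B n" using B_sub by blast
    then show ?thesis unfolding N_def by (rule LeastI)
  qed
  define f where "f y = N y mod 2" for y
  have range: "f y \<in> {0, 1}" for y unfolding f_def by auto
  have "openin T {y \<in> carrier K - {z}. f y = s}" for s
  proof (subst openin_subopen, intro ballI)
    fix y assume "y \<in> {y \<in> carrier K - {z}. f y = s}"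
    then have y: "y \<in> carrier K" "y \<noteq> z" "f y = s" by auto
    \<comment> \<open>Membership in \<open>B 0\<close> up to \<open>B (N y)\<close> does not change
      within the coset of \<open>V (r (N y))\<close> through \<open>y\<close>, so the depth is
      constant there.\<close>
    have "w \<in> {y \<in> carrier K - {z}. f y = s}" if w: "w \<in> y <# V (r (N y))" for w
    proof -
      have wc: "w \<in> carrier K" using w lcoset_subset[OF y(1)] by blast
      have iff: "w \<in> B j \<longleftrightarrow> y \<in> B j" if "j \<le> N y" for j
      proof -
        have "w \<in> y <# V (r j)" using w Vr_dec[OF that] by (auto simp: l_coset_def)
        then have "w <# V (r j) = y <# V (r j)" by (rule lcoset_eq[OF y(1)])
        then show ?thesis unfolding B_def
          using lcoset_eq[OF z] lcoset_self[OF wc] lcoset_self[OF y(1)] by metis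
      qed
      have "w \<notin> B (N y)" using iff[of "N y"] B_N[OF y(1,2)] by simp
      moreover have "w \<in> B n" if "n < N y" for n using iff[of n] B_lt that by simp
      ultimately have "N w = N y" unfolding N_def[of w] by (intro Least_equality) (auto simp: not_less[symmetric])
      moreover have "z \<in> B (N y)" using lcoset_self[OF z] by (simp add: B_def)
      ultimately show ?thesis using wc y(3) \<open>w \<notin> B (N y)\<close> by (auto simp: f_def)
    qed
    then show "\<exists>U. openin T U \<and> y \<in> U \<and> U \<subseteq> {y \<in> carrier K - {z}. f y = s}"
      using lcoset_open[OF y(1)] lcoset_self[OF y(1)] by blast
  qed
  moreover have "\<exists>y\<in>U - {z}. f y = s" if U: "openin T U" "z \<in> U" and s: "s \<in> {0, 1}" for U s
  proof -
    obtain n where n: "z <# V n \<subseteq> U" using lcoset_basis[OF U] by blast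
    \<comment> \<open>Points of \<open>B m\<close> outside \<open>B (Suc m)\<close> have depth
      \<open>Suc m\<close>; the index is shifted by one if necessary so that this depth has parity
      \<open>s\<close>.\<close>
    define m where "m = (if n mod 2 = s then Suc n else n)"
    have m: "n \<le> m" "Suc m mod 2 = s" using s by (auto simp: m_def mod_Suc)
    obtain v where v: "v \<in> V (r m)" "v \<notin> V (r (Suc m))" using r(2)[of m] by blast
    have vc: "v \<in> carrier K" using subgroup.mem_carrier[OF V_subgroup v(1)] .
    have in_m: "z \<otimes> v \<in> B m" and notin: "z \<otimes> v \<notin> B (Suc m)"
      using v vc z by (auto simp: B_def lcoset_iff)
    have "N (z \<otimes> v) = Suc m" unfolding N_def
    proof (rule Least_equality, rule notin, rule ccontr)
      fix j assume "z \<otimes> v \<notin> B j" "\<not> Suc m \<le> j"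
      then show False using in_m B_dec[of j m] by auto
    qed
    then have "f (z \<otimes> v) = s" using m(2) by (simp add: f_def)
    moreover have "z \<otimes> v \<in> U" using in_m B_dec[OF m(1)] B_sub[of n] n by blast
    moreover have "z \<otimes> v \<noteq> z" using notin lcoset_self[OF z] by (auto simp: B_def)
    ultimately show ?thesis by blast
  qed
  ultimately show thesis using that range by blast
qed

end

lemma (in profinite_group) essential_discontinuity:
  assumes inf: "infinite (carrier K)" and z: "z \<in> carrier K"
  obtains f :: "'k \<Rightarrow> nat"
  where "\<And>y. f y \<in> {0, 1}" "\<And>s. openin T {y \<in> carrier K - {z}. f y = s}"
    "\<And>U s. openin T U \<Longrightarrow> z \<in> U \<Longrightarrow> s \<in> {0, 1} \<Longrightarrow> \<exists>y\<in>U - {z}. f y = s"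
proof -
  obtain V where V: "\<And>n. subgroup (V n) K" "\<And>n. openin T (V n)" "decseq V"
    "\<And>U. openin T U \<Longrightarrow> \<one> \<in> U \<Longrightarrow> \<exists>n. V n \<subseteq> U"
    using open_subgroup_chain by blast
  interpret profinite_chain K T V
    by (intro profinite_chain.intro profinite_group_axioms profinite_chain_axioms.intro V)
  show thesis by (rule discontinuity_chain[OF inf z]) (rule that)
qed

section \<open>Existence of an aperiodic coding\<close>

lemma (in profinite_group) toeplitz_coding_exists:
  fixes G :: "'g monoid"
  assumes G: "group G" "countable (carrier G)" and hom: "i \<in> hom G K"
    and dense: "T closure_of (i ` carrier G) = topspace T"
  shows "\<exists>(f :: 'k \<Rightarrow> nat) D. toeplitz_coding K T G i {0, 1} f D"
proof (cases "finite (carrier K)")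
  case True
  define f :: "'k \<Rightarrow> nat" where "f y = (if y = \<one> then 1 else 0)" for y
  have "T = discrete_topology (carrier K)"
    using True metrizable_imp_t1_space[OF metrizable]
    by (intro finite_t1_space_imp_discrete_topology) (simp_all add: topspace)
  then have "openin T A \<longleftrightarrow> A \<subseteq> carrier K" for A by simp
  then have f_open: "openin T {y \<in> carrier K - {}. f y = s}" for s by auto
  \<comment> \<open>Evaluating the period at \<open>inv c\<close> compares
    \<open>f \<one> = 1\<close> with \<open>f (inv c)\<close>, which forces \<open>inv c\<close> to
    be the identity.\<close>
  have aperiodic: "c = \<one>" if c: "c \<in> carrier K"
    and eq: "\<And>y. y \<in> carrier K - {} \<Longrightarrow> c \<otimes> y \<notin> {} \<Longrightarrow> f (c \<otimes> y) = f y" for c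
    using eq[of "inv c"] c by (auto simp: f_def inv_eq_1_iff split: if_splits)
  have "toeplitz_coding K T G i {0, 1} f {}"
    by (intro toeplitz_coding.intro toeplitz_coding_axioms.intro acting_group.intro
        profinite_group_axioms G hom dense f_open aperiodic) (assumption | simp add: f_def)+
  then show ?thesis by blast
next
  case inf: False
  obtain \<mu> where \<mu>: "haar_prob K T \<mu>" using haar_prob_exists by blast
  have iG: "countable (i ` carrier G)" "i ` carrier G \<subseteq> carrier K"
    using G(2) hom_carrier[OF hom] by simp_all
  \<comment> \<open>The countable image of \<open>G\<close> is Haar-null in the infinite group
    \<open>K\<close>, so it leaves room for a discontinuity \<open>z\<close>.\<close>
  have "i ` carrier G \<noteq> carrier K"
  proof
    assume "i ` carrier G = carrier K"
    then have "carrier K \<in> null_sets \<mu>" using countable_null_set[OF \<mu> inf iG] by simp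
    moreover have "emeasure \<mu> (carrier K) = 1" using \<mu> by (simp add: haar_prob_def topspace)
    ultimately show False by (simp add: null_sets_def)
  qed
  then obtain z where z: "z \<in> carrier K" "z \<notin> i ` carrier G" using iG(2) by blast
  obtain f :: "'k \<Rightarrow> nat" where f: "\<And>y. f y \<in> {0, 1}" "\<And>s. openin T {y \<in> carrier K - {z}. f y = s}"
    "\<And>U s. openin T U \<Longrightarrow> z \<in> U \<Longrightarrow> s \<in> {0, 1} \<Longrightarrow> \<exists>y\<in>U - {z}. f y = s"
    by (rule essential_discontinuity[OF inf z(1)]) (rule that)
  have aperiodic: "c = \<one>" if c: "c \<in> carrier K"
    and eq: "\<And>y. y \<in> carrier K - {z} \<Longrightarrow> c \<otimes> y \<notin> {z} \<Longrightarrow> f (c \<otimes> y) = f y" for c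
  proof (rule ccontr)
    assume "c \<noteq> \<one>"
    then have cz: "c \<otimes> z \<noteq> z" using c z(1) by simp
    \<comment> \<open>A neighbourhood of \<open>z\<close> whose translate by \<open>c\<close> avoids
      \<open>z\<close> and has constant value \<open>f (c \<otimes> z)\<close>. The period would
      carry this constant to \<open>U - {z}\<close>, where both values occur.\<close>
    define U where "U = {y \<in> topspace T. c \<otimes> y \<in> {w \<in> carrier K - {z}. f w = f (c \<otimes> z)}}"
    have U: "openin T U" unfolding U_def
      by (rule openin_continuous_map_preimage[OF continuous_translate[OF c] f(2)])
    have zU: "z \<in> U" using cz c z(1) by (simp add: U_def topspace)
    have "f y = f (c \<otimes> z)" if "y \<in> U - {z}" for y
      using eq[of y] that by (auto simp: U_def topspace)
    then have "s = f (c \<otimes> z)" if "s \<in> {0, 1}" for s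
      using f(3)[OF U zU that] by metis
    from this[of 0] this[of 1] show False by simp
  qed
  have "toeplitz_coding K T G i {0, 1} f {z}"
  proof (intro toeplitz_coding.intro toeplitz_coding_axioms.intro acting_group.intro
      profinite_group_axioms G hom dense f(1,2) inf aperiodic)
    show "i g \<notin> {z}" if "g \<in> carrier G" for g using z(2) that by blast
  qed (assumption | simp add: z(1))+
  then show ?thesis by blast
qed

theorem theorem1p2:
  fixes G :: "'g monoid" and K :: "'k monoid" and T :: "'k topology" and i :: "'g \<Rightarrow> 'k"
  assumes "group G" and "countable (carrier G)" and "residually_finite G"
    and "td_metric_compactification G K T i"
  shows "\<exists>(S :: nat set) X \<pi>. finite S \<and> card S \<ge> 2 \<and>
           toeplitz_subshift G S X \<and> uniquely_ergodic G S X \<and>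
           almost_one_one_factor G S X K T i \<pi> \<and>
           (\<forall>\<nu> \<mu>. invariant_prob G S X \<nu> \<longrightarrow> haar_prob K T \<mu> \<longrightarrow>
              measure_conjugacy \<nu> \<mu> (shift G) (\<lambda>g y. i g \<otimes>\<^bsub>K\<^esub> y) (carrier G) \<pi>)"
proof -
  have K: "profinite_group K T"
    using assms(4)
    by (auto simp: td_metric_compactification_def topological_group_def profinite_group_def
        profinite_group_axioms_def)
  obtain f :: "'k \<Rightarrow> nat" and D where "toeplitz_coding K T G i {0, 1} f D"
    using profinite_group.toeplitz_coding_exists[OF K assms(1,2)] assms(4)
    unfolding td_metric_compactification_def by blast
  then interpret toeplitz_coding K T G i "{0, 1}" f D .
  have "toeplitz_subshift G {0, 1} X"
    using toeplitz_\<eta> unfolding toeplitz_subshift_def X_def by blast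
  then show ?thesis
    using uniquely_ergodic almost_one_one measure_conjugacy_\<pi>
    by (intro exI[of _ "{0, 1}"] exI[of _ X] exI[of _ \<pi>]) simp
qed

end
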